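(* Let $X_1,\dots,X_n$ be i.i.d. real random variables with probability density $f$, and let $f_n(x;h)$ be the sinc estimator of $f$. Let $m\ge0$ be an integer, and suppose that $f$ is $m$ times differentiable and its $m$-th derivative $f^{(m)}$ has finite total variation. Then, for all $n\ge 1$ and $h>0$, $$\mathrm{MISE}(f_n(x;h))\le h^{2m+1}\frac{Vr(f^{(m)})^2}{(2m+1)\pi}+\frac{1}{\pi nh}.$$
   Context: The sinc estimator with bandwidth $h>0$ is $f_n(x;h)=\frac{1}{\pi n}\sum_{j=1}^n\frac{\sin[(x-X_j)/h]}{x-X_j}$. $\mathrm{MISE}(f_n(x;h))=\mathrm{E}\int_{-\infty}^{\infty}[f_n(x;h)-f(x)]^2\,dx$. $Vr(g)$ denotes the total variation of a function $g$ over $\mathbb{R}$. The $0$-th derivative is $f^{(0)}=f$. *)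

theory Defs
  imports "HOL-Probability.Probability"
begin

text \<open>
  The summand at a sample point, where the formula reads \<open>0/0\<close>, takes its limit \<open>1/h\<close>
  (division by zero would give \<open>0\<close>).
\<close>
definition sinc_estimator :: "nat \<Rightarrow> (nat \<Rightarrow> real) \<Rightarrow> real \<Rightarrow> real \<Rightarrow> real" where
  "sinc_estimator n X h x =
     1 / (pi * real n) *
     (\<Sum>j=1..n. if x = X j then 1 / h else sin ((x - X j) / h) / (x - X j))"

text \<open>
  Mean integrated squared error of a random function \<open>g\<close> (depending on the outcome \<open>\<omega>\<close>) as an
  estimator of \<open>f\<close>. It takes values in the extended nonnegative reals, so that an upper bound
  by a real number includes finiteness.
\<close>
definition MISE :: "'a measure \<Rightarrow> ('a \<Rightarrow> real \<Rightarrow> real) \<Rightarrow> (real \<Rightarrow> real) \<Rightarrow> ennreal" where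
  "MISE M g f = (\<integral>\<^sup>+\<omega>. (\<integral>\<^sup>+x. ennreal ((g \<omega> x - f x)\<^sup>2) \<partial>lborel) \<partial>M)"

text \<open>Total variation over the whole real line; the points \<open>t 0 \<le> \<dots> \<le> t N\<close> form the partition.\<close>
definition total_variation :: "(real \<Rightarrow> real) \<Rightarrow> ennreal" where
  "total_variation g =
     (SUP (N, t) \<in> {(N :: nat, t :: nat \<Rightarrow> real). mono t}.
        ennreal (\<Sum>i<N. \<bar>g (t (Suc i)) - g (t i)\<bar>))"

definition times_differentiable :: "nat \<Rightarrow> (real \<Rightarrow> real) \<Rightarrow> bool" where
  "times_differentiable m f \<longleftrightarrow> (\<forall>k<m. \<forall>x. (deriv ^^ k) f differentiable (at x))"

end

theory Submission
  imports Defs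
begin

text \<open>
  The estimator is the sample average of \<open>sinc_kernel h (x - X j)\<close>, so at a fixed point \<open>x\<close> its mean
  squared error splits into variance and squared bias (\<open>mean_square_error_of_average\<close>), and the two
  parts are integrated over \<open>x\<close> separately.

  The variance is at most \<open>1 / n\<close> times the second moment of \<open>sinc_kernel h (x - X 1)\<close>. Integrated
  over \<open>x\<close>, this is \<open>1 / n\<close> times the square integral of the kernel, whatever the density. The kernel
  is the inverse Fourier transform of the indicator of the band \<open>\<bar>t\<bar> \<le> 1 / h\<close>, so Plancherel's
  inequality gives \<open>1 / (pi * n * h)\<close>.

  The expectation of the estimator is obtained from \<open>f\<close> by cutting its characteristic function \<open>\<phi>\<close> off
  outside the band. Hence the integrated squared bias is at most \<open>1 / (2 * pi)\<close> times the integral of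
  \<open>\<bar>\<phi> t\<bar>\<^sup>2\<close> over \<open>\<bar>t\<bar> > 1 / h\<close> (\<open>bias_bound\<close>). Bounded variation of the \<open>m\<close>-th derivative, with
  variation \<open>V\<close>, gives \<open>\<bar>\<phi> t\<bar> \<le> V / \<bar>t\<bar> ^ (m + 1)\<close> (\<open>fourier_decay\<close>), and integrating the square of
  this bound yields the first term.

  Two points need care, since \<open>\<phi>\<close> need not be integrable and \<open>f\<close> may be discontinuous. Plancherel's
  inequality is proved directly with Gaussian weights (\<open>plancherel_le\<close>) and applied only to functions
  supported in a bounded band. Inversion is applied to averages of \<open>f\<close> over short intervals, by Levy's theorem;
  these converge to \<open>f\<close> almost everywhere, and Fatou's lemma carries the bound to the limit.
\<close>

section \<open>Plancherel's inequality\<close>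

text \<open>
  Fatou's lemma for a varying bound. It serves to remove the Gaussian weight in Plancherel's
  inequality and, for the bias, to let first the band and then the averaging length go to the limit.
\<close>
lemma nn_integral_le_limit:
  fixes u :: "nat \<Rightarrow> 'a \<Rightarrow> ennreal"
  assumes meas: "\<And>i. u i \<in> borel_measurable M"
    and lim: "AE x in M. (\<lambda>i. u i x) \<longlonglongrightarrow> v x"
    and bound: "eventually (\<lambda>i. (\<integral>\<^sup>+x. u i x \<partial>M) \<le> C i) sequentially"
    and C: "C \<longlonglongrightarrow> L"
  shows "(\<integral>\<^sup>+x. v x \<partial>M) \<le> L"
proof -
  have "(\<integral>\<^sup>+x. v x \<partial>M) = (\<integral>\<^sup>+x. liminf (\<lambda>i. u i x) \<partial>M)"
    by (intro nn_integral_cong_AE eventually_mono[OF lim]) (simp add: lim_imp_Liminf)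
  also have "\<dots> \<le> liminf (\<lambda>i. \<integral>\<^sup>+x. u i x \<partial>M)"
    by (intro nn_integral_liminf meas)
  also have "\<dots> \<le> liminf C"
    by (rule Liminf_mono[OF bound])
  also have "\<dots> = L"
    using C by (simp add: lim_imp_Liminf)
  finally show ?thesis .
qed

text \<open>
  The factor \<open>c\<close> fixes the sign convention: \<open>c = 1\<close> gives characteristic functions, \<open>c = -1\<close>
  gives the inverse transform up to the factor \<open>1 / (2 * pi)\<close>.
\<close>
definition fourier :: "real \<Rightarrow> (real \<Rightarrow> complex) \<Rightarrow> real \<Rightarrow> complex" where
  "fourier c b x = (LINT t|lborel. iexp (c * t * x) * b t)"

lemma fourier_measurable [measurable]:
  assumes [measurable]: "b \<in> borel_measurable borel"
  shows "fourier c b \<in> borel_measurable borel"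
  unfolding fourier_def by measurable

lemma norm_fourier_le:
  "norm (fourier c b x) \<le> (LINT t|lborel. norm (b t))"
  unfolding fourier_def
  by (rule order_trans[OF integral_norm_bound]) (simp add: norm_mult)

lemma cnj_fourier: "cnj (fourier c b x) = fourier (- c) (\<lambda>t. cnj (b t)) x"
  unfolding fourier_def
  by (subst Bochner_Integration.integral_cnj[symmetric]) (simp add: exp_cnj)

lemma integrable_iexp_mult:
  assumes "integrable lborel b"
  shows "integrable lborel (\<lambda>t. iexp (c * t) * (b t :: complex))"
proof (rule Bochner_Integration.integrable_bound[OF assms])
  have [measurable]: "b \<in> borel_measurable borel" using assms by auto
  show "(\<lambda>t. iexp (c * t) * b t) \<in> borel_measurable lborel" by measurable
qed (simp add: norm_mult)

lemma fourier_diff: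
  assumes "integrable lborel a" "integrable lborel b"
  shows "fourier c (\<lambda>t. a t - b t) x = fourier c a x - fourier c b x"
proof -
  have "integrable lborel (\<lambda>t. iexp (c * t * x) * a t)" if "integrable lborel a" for a
    using integrable_iexp_mult[OF that, of "c * x"] by (simp add: mult_ac)
  then show ?thesis
    unfolding fourier_def using assms
    by (subst Bochner_Integration.integral_diff[symmetric]) (simp_all add: right_diff_distrib)
qed

text \<open>
  Fubini's theorem for the kernel \<open>iexp (c * t * x)\<close>, which is symmetric in \<open>t\<close> and \<open>x\<close>. It
  replaces all manipulations of double and triple oscillatory integrals.
\<close>
lemma fourier_exchange:
  assumes a: "integrable lborel a" and b: "integrable lborel b"
  shows "(LINT x|lborel. a x * fourier c b x) = (LINT t|lborel. b t * fourier c a t)"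
proof -
  have am [measurable]: "a \<in> borel_measurable borel" and bm [measurable]: "b \<in> borel_measurable borel"
    using a b by auto
  have nn: "(\<integral>\<^sup>+x. ennreal (norm (f x)) \<partial>lborel) < \<infinity>" if "integrable lborel f" for f :: "real \<Rightarrow> complex"
    using that by (simp add: integrable_iff_bounded)
  have "integrable (lborel \<Otimes>\<^sub>M lborel) (\<lambda>(x, t). a x * (iexp (c * t * x) * b t))"
  proof (rule integrableI_bounded)
    show "(\<lambda>(x, t). a x * (iexp (c * t * x) * b t)) \<in> borel_measurable (lborel \<Otimes>\<^sub>M lborel)"
      by measurable
    have "(\<integral>\<^sup>+z. ennreal (norm (case z of (x, t) \<Rightarrow> a x * (iexp (c * t * x) * b t))) \<partial>(lborel \<Otimes>\<^sub>M lborel))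
        = (\<integral>\<^sup>+x. \<integral>\<^sup>+t. ennreal (norm (a x)) * ennreal (norm (b t)) \<partial>lborel \<partial>lborel)"
      by (subst lborel.nn_integral_fst[symmetric]) (simp_all add: norm_mult ennreal_mult')
    also have "\<dots> = (\<integral>\<^sup>+x. ennreal (norm (a x)) \<partial>lborel) * (\<integral>\<^sup>+t. ennreal (norm (b t)) \<partial>lborel)"
      by (simp add: nn_integral_cmult nn_integral_multc)
    also have "\<dots> < \<infinity>"
      using nn[OF a] nn[OF b] by (simp add: ennreal_mult_less_top)
    finally show "(\<integral>\<^sup>+z. ennreal (norm (case z of (x, t) \<Rightarrow> a x * (iexp (c * t * x) * b t))) \<partial>(lborel \<Otimes>\<^sub>M lborel)) < \<infinity>" .
  qed
  then have "(LINT t|lborel. LINT x|lborel. a x * (iexp (c * t * x) * b t))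
      = (LINT x|lborel. LINT t|lborel. a x * (iexp (c * t * x) * b t))"
    by (rule lborel_pair.Fubini_integral)
  also have "\<dots> = (LINT x|lborel. a x * fourier c b x)"
    unfolding fourier_def by (subst integral_mult_right_zero) simp
  also have "(LINT t|lborel. LINT x|lborel. a x * (iexp (c * t * x) * b t))
      = (LINT t|lborel. b t * fourier c a t)"
    unfolding fourier_def by (subst integral_mult_right_zero[symmetric]) (simp add: mult_ac)
  finally show ?thesis by simp
qed

text \<open>
  Rescalings of the known characteristic function of the standard normal distribution; the
  mass is the transform at \<open>0\<close>.
\<close>
lemma gaussian_integral:
  assumes "s > 0"
  shows "integrable lborel (\<lambda>x. complex_of_real (exp (- (x / s)\<^sup>2 / 2)))"
    and "fourier 1 (\<lambda>x. complex_of_real (exp (- (x / s)\<^sup>2 / 2))) u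
      = complex_of_real (s * sqrt (2 * pi) * exp (- (s * u)\<^sup>2 / 2))"
    and "(\<integral>\<^sup>+x. ennreal (exp (- (x / s)\<^sup>2 / 2)) \<partial>lborel) = ennreal (s * sqrt (2 * pi))"
proof -
  have g: "exp (- (x / s)\<^sup>2 / 2) = sqrt (2 * pi) * std_normal_density (0 + (1 / s) * x)" for x
    by (simp add: std_normal_density_def)
  have "integrable lborel (\<lambda>x. sqrt (2 * pi) * std_normal_density (0 + (1 / s) * x))"
    using assms by (intro integrable_mult_right lborel_integrable_real_affine) auto
  then have i: "integrable lborel (\<lambda>x. exp (- (x / s)\<^sup>2 / 2))"
    unfolding g .
  then show "integrable lborel (\<lambda>x. complex_of_real (exp (- (x / s)\<^sup>2 / 2)))"
    by (rule integrable_of_real)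
  have F: "(LINT y|lborel. std_normal_density y *\<^sub>R iexp (v * y)) = exp (- (v^2) / 2)" for v
    using fun_cong[OF char_std_normal_distribution, of v]
    by (simp add: char_def integral_density)
  have gs: "exp (- ((0 + s * y) / s)\<^sup>2 / 2) = sqrt (2 * pi) * std_normal_density y" for y
      using assms by (simp add: std_normal_density_def)
  show FT: "fourier 1 (\<lambda>x. complex_of_real (exp (- (x / s)\<^sup>2 / 2))) u
      = complex_of_real (s * sqrt (2 * pi) * exp (- (s * u)\<^sup>2 / 2))" for u
  proof -
    have "fourier 1 (\<lambda>x. complex_of_real (exp (- (x / s)\<^sup>2 / 2))) u
      = s *\<^sub>R (LINT y|lborel. iexp (1 * (0 + s * y) * u) * complex_of_real (sqrt (2 * pi) * std_normal_density y))"
      unfolding fourier_def gs[symmetric] using assms by (subst lborel_integral_real_affine[of s _ 0]) auto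
    also have "(LINT y|lborel. iexp (1 * (0 + s * y) * u) * complex_of_real (sqrt (2 * pi) * std_normal_density y))
      = (LINT y|lborel. complex_of_real (sqrt (2 * pi)) * (std_normal_density y *\<^sub>R iexp ((s * u) * y)))"
      by (simp add: scaleR_conv_of_real mult_ac)
    also have "\<dots> = complex_of_real (sqrt (2 * pi)) * exp (- ((s * u)^2) / 2)"
      by (subst integral_mult_right_zero, subst F) simp
    finally show ?thesis by (simp add: scaleR_conv_of_real mult_ac)
  qed
  have "complex_of_real (LINT x|lborel. exp (- (x / s)\<^sup>2 / 2)) = complex_of_real (s * sqrt (2 * pi))"
    using FT[of 0] by (simp add: fourier_def)
  then have "(LINT x|lborel. exp (- (x / s)\<^sup>2 / 2)) = s * sqrt (2 * pi)"
    by (simp only: of_real_eq_iff)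
  then show "(\<integral>\<^sup>+x. ennreal (exp (- (x / s)\<^sup>2 / 2)) \<partial>lborel) = ennreal (s * sqrt (2 * pi))"
    using i by (subst nn_integral_eq_integral) auto
qed

text \<open>
  Multiplied out, the left side is
  \<open>\<integral>\<integral> \<psi> t * cnj (\<psi> r) * k (r - t)\<close>, where \<open>k\<close>, the transform of the weight, is nonnegative with
  total mass \<open>2 * pi\<close> whatever the width \<open>s\<close>. Estimating \<open>\<bar>\<psi> t\<bar> * \<bar>\<psi> r\<bar>\<close> by the mean of the two
  squares and integrating \<open>k\<close> out first gives the bound.
\<close>
lemma plancherel_le_gaussian_weight:
  assumes psi: "integrable lborel \<psi>" and s: "s > 0"
  shows "(\<integral>\<^sup>+x. ennreal (exp (- (x / s)\<^sup>2 / 2) * (norm (fourier (-1) \<psi> x))\<^sup>2) \<partial>lborel)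
    \<le> ennreal (2 * pi) * (\<integral>\<^sup>+t. ennreal ((norm (\<psi> t))\<^sup>2) \<partial>lborel)"
proof -
  define w where "w x = exp (- (x / s)\<^sup>2 / 2)" for x
  define k where "k u = s * sqrt (2 * pi) * exp (- (s * u)\<^sup>2 / 2)" for u
  define g where "g = fourier (-1) \<psi>"
  have pm [measurable]: "\<psi> \<in> borel_measurable borel" using psi by auto
  have gm [measurable]: "g \<in> borel_measurable borel" unfolding g_def by measurable
  have cgm [measurable]: "(\<lambda>x. cnj (g x)) \<in> borel_measurable borel"
    by (rule measurable_compose[OF gm borel_measurable_continuous_onI]) (intro continuous_intros)
  have wm [measurable]: "w \<in> borel_measurable borel" unfolding w_def by measurable
  have km [measurable]: "k \<in> borel_measurable borel" unfolding k_def by measurable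
  have wi: "integrable lborel (\<lambda>x. complex_of_real (w x))"
    unfolding w_def using gaussian_integral(1)[OF s] .
  define B where "B = (LINT t|lborel. norm (\<psi> t))"
  have B: "norm (g x) \<le> B" for x unfolding g_def B_def by (rule norm_fourier_le)
  have k0: "k u \<ge> 0" for u using s by (simp add: k_def)
  have kint: "(\<integral>\<^sup>+u. ennreal (k (a + c * u)) \<partial>lborel) = ennreal (2 * pi)" if "\<bar>c\<bar> = 1" for a c
  proof -
    have "(\<integral>\<^sup>+u. ennreal (k (a + c * u)) \<partial>lborel) = (\<integral>\<^sup>+u. ennreal (k u) \<partial>lborel)"
      using that by (subst (2) nn_integral_real_affine[where c=c and t=a]) auto
    also have "\<dots> = (\<integral>\<^sup>+u. ennreal (s * sqrt (2 * pi)) * ennreal (exp (- (u / (1 / s))\<^sup>2 / 2)) \<partial>lborel)"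
      using s by (simp add: k_def ennreal_mult' mult.commute[of _ s])
    also have "\<dots> = ennreal (s * sqrt (2 * pi)) * ennreal (1 / s * sqrt (2 * pi))"
      using s by (subst nn_integral_cmult, measurable)
        (subst gaussian_integral(3), auto)
    also have "\<dots> = ennreal (2 * pi)"
      using s by (subst ennreal_mult'[symmetric]) auto
    finally show ?thesis .
  qed
  have wgi: "integrable lborel (\<lambda>x. complex_of_real (w x) * cnj (g x))"
  proof (rule Bochner_Integration.integrable_bound)
    show "integrable lborel (\<lambda>x. complex_of_real B * complex_of_real (w x))"
      using wi by simp
    show "(\<lambda>x. complex_of_real (w x) * cnj (g x)) \<in> borel_measurable lborel"
      by measurable
    show "AE x in lborel. norm (complex_of_real (w x) * cnj (g x)) \<le> norm (complex_of_real B * complex_of_real (w x))"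
      using B order_trans[OF norm_ge_zero B]
      by (intro AE_I2) (auto simp: norm_mult mult.commute[of B] intro!: mult_left_mono)
  qed
  \<comment> \<open>Expanding \<open>cnj (g x)\<close> and exchanging moves the transform onto the weight, where it becomes \<open>k\<close> at
    the difference of the two frequencies.\<close>
  have inner: "fourier (-1) (\<lambda>x. complex_of_real (w x) * cnj (g x)) t
      = (LINT r|lborel. cnj (\<psi> r) * complex_of_real (k (r - t)))" for t
  proof -
    have ft: "fourier 1 (\<lambda>x. iexp ((- t) * x) * complex_of_real (w x)) r = complex_of_real (k (r - t))" for r
    proof -
      have "fourier 1 (\<lambda>x. iexp ((- t) * x) * complex_of_real (w x)) r = fourier 1 (\<lambda>x. complex_of_real (w x)) (r - t)"
        unfolding fourier_def
        by (intro Bochner_Integration.integral_cong) (auto simp: algebra_simps exp_diff exp_minus divide_simps)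
      also have "\<dots> = complex_of_real (k (r - t))"
        unfolding w_def k_def using gaussian_integral(2)[OF s] .
      finally show ?thesis .
    qed
    have "fourier (-1) (\<lambda>x. complex_of_real (w x) * cnj (g x)) t
        = (LINT x|lborel. (iexp ((- t) * x) * complex_of_real (w x)) * fourier 1 (\<lambda>r. cnj (\<psi> r)) x)"
      unfolding fourier_def[of "-1" _ t] g_def cnj_fourier by (simp add: mult_ac)
    also have "\<dots> = (LINT r|lborel. cnj (\<psi> r) * fourier 1 (\<lambda>x. iexp ((- t) * x) * complex_of_real (w x)) r)"
      using psi by (intro fourier_exchange integrable_iexp_mult wi) simp
    also have "\<dots> = (LINT r|lborel. cnj (\<psi> r) * complex_of_real (k (r - t)))"
      unfolding ft ..
    finally show ?thesis .
  qed
  define P where "P t = ennreal ((norm (\<psi> t))\<^sup>2)" for t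
  have [measurable]: "P \<in> borel_measurable borel" unfolding P_def by measurable
  have nb: "ennreal (norm (integral\<^sup>L lborel f)) \<le> (\<integral>\<^sup>+x. ennreal (norm (f x)) \<partial>lborel)" for f :: "real \<Rightarrow> complex"
    by (cases "integrable lborel f") (auto simp: integral_norm_bound_ennreal not_integrable_integral_eq)
  have "(\<integral>\<^sup>+x. ennreal (w x * (norm (g x))\<^sup>2) \<partial>lborel) = ennreal (norm (LINT x|lborel. (w x * cnj (g x)) * g x))"
  proof -
    have i: "integrable lborel (\<lambda>x. w x * (norm (g x))\<^sup>2)"
    proof (rule Bochner_Integration.integrable_bound)
      show "integrable lborel (\<lambda>x. complex_of_real (B\<^sup>2) * complex_of_real (w x))"
        using wi by (intro integrable_mult_right) simp
      show "(\<lambda>x. w x * (norm (g x))\<^sup>2) \<in> borel_measurable lborel" by measurable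
      show "AE x in lborel. norm (w x * (norm (g x))\<^sup>2) \<le> norm (complex_of_real (B\<^sup>2) * complex_of_real (w x))"
        using B by (intro AE_I2) (auto simp: norm_mult abs_mult norm_power mult.commute[of _ "\<bar>w _\<bar>"]
          simp del: of_real_power intro!: mult_left_mono power_mono)
    qed
    have "(LINT x|lborel. (w x * cnj (g x)) * g x) = (LINT x|lborel. complex_of_real (w x * (norm (g x))\<^sup>2))"
      by (intro Bochner_Integration.integral_cong)
         (auto simp: complex_norm_square mult_ac simp del: of_real_power)
    also have "\<dots> = complex_of_real (LINT x|lborel. w x * (norm (g x))\<^sup>2)"
      by (simp del: of_real_power of_real_mult)
    finally have e: "norm (LINT x|lborel. (w x * cnj (g x)) * g x) = \<bar>LINT x|lborel. w x * (norm (g x))\<^sup>2\<bar>"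
      by (simp only: norm_of_real)
    show ?thesis
      unfolding e using i by (subst nn_integral_eq_integral) (auto simp: w_def)
  qed
  also have "(LINT x|lborel. (w x * cnj (g x)) * g x)
      = (LINT t|lborel. \<psi> t * (LINT r|lborel. cnj (\<psi> r) * complex_of_real (k (r - t))))"
    unfolding g_def by (subst fourier_exchange[OF wgi[unfolded g_def] psi]) (simp add: inner[unfolded g_def])
  also have "ennreal (norm \<dots>)
      \<le> (\<integral>\<^sup>+t. ennreal (norm (\<psi> t)) * ennreal (norm (LINT r|lborel. cnj (\<psi> r) * complex_of_real (k (r - t)))) \<partial>lborel)"
    by (rule order_trans[OF nb]) (simp add: norm_mult ennreal_mult')
  also have "\<dots> \<le> (\<integral>\<^sup>+t. ennreal (norm (\<psi> t)) * (\<integral>\<^sup>+r. ennreal (norm (\<psi> r) * k (r - t)) \<partial>lborel) \<partial>lborel)"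
    using k0 by (intro nn_integral_mono mult_left_mono order_trans[OF nb]) (auto simp: norm_mult)
  also have "\<dots> = (\<integral>\<^sup>+t. \<integral>\<^sup>+r. ennreal (norm (\<psi> t)) * ennreal (norm (\<psi> r) * k (r - t)) \<partial>lborel \<partial>lborel)"
    by (simp add: nn_integral_cmult)
  also have "\<dots> \<le> (\<integral>\<^sup>+t. \<integral>\<^sup>+r. ennreal (1 / 2) * (P t * ennreal (k (r - t)) + P r * ennreal (k (r - t))) \<partial>lborel \<partial>lborel)"
  proof (intro nn_integral_mono)
    fix t r
    have "norm (\<psi> t) * (norm (\<psi> r) * k (r - t)) = (norm (\<psi> t) * norm (\<psi> r)) * k (r - t)" by simp
    also have "\<dots> \<le> (((norm (\<psi> t))\<^sup>2 + (norm (\<psi> r))\<^sup>2) / 2) * k (r - t)"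
      using k0 sum_squares_bound[of "norm (\<psi> t)" "norm (\<psi> r)"] by (intro mult_right_mono) auto
    finally have "ennreal (norm (\<psi> t) * (norm (\<psi> r) * k (r - t)))
        \<le> ennreal (1 / 2 * ((norm (\<psi> t))\<^sup>2 * k (r - t) + (norm (\<psi> r))\<^sup>2 * k (r - t)))"
      by (intro ennreal_leI) (simp add: field_simps)
    also have "\<dots> = ennreal (1 / 2) * (P t * ennreal (k (r - t)) + P r * ennreal (k (r - t)))"
      unfolding P_def using k0 by (subst ennreal_mult', simp, subst ennreal_plus) (auto simp: ennreal_mult')
    finally show "ennreal (norm (\<psi> t)) * ennreal (norm (\<psi> r) * k (r - t))
        \<le> ennreal (1 / 2) * (P t * ennreal (k (r - t)) + P r * ennreal (k (r - t)))"
      by (simp add: ennreal_mult')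
  qed
  also have "\<dots> = ennreal (1 / 2) * ((\<integral>\<^sup>+t. \<integral>\<^sup>+r. P t * ennreal (k (r - t)) \<partial>lborel \<partial>lborel)
                          + (\<integral>\<^sup>+t. \<integral>\<^sup>+r. P r * ennreal (k (r - t)) \<partial>lborel \<partial>lborel))"
    by (simp add: nn_integral_cmult nn_integral_add)
  also have "(\<integral>\<^sup>+t. \<integral>\<^sup>+r. P r * ennreal (k (r - t)) \<partial>lborel \<partial>lborel)
      = (\<integral>\<^sup>+r. \<integral>\<^sup>+t. P r * ennreal (k (r - t)) \<partial>lborel \<partial>lborel)"
    by (rule lborel_pair.Fubini') measurable
  also have "\<dots> = (\<integral>\<^sup>+r. P r \<partial>lborel) * ennreal (2 * pi)"
    using kint[of "-1"] by (simp add: nn_integral_cmult nn_integral_multc)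
  also have "(\<integral>\<^sup>+t. \<integral>\<^sup>+r. P t * ennreal (k (r - t)) \<partial>lborel \<partial>lborel) = (\<integral>\<^sup>+r. P r \<partial>lborel) * ennreal (2 * pi)"
    using kint[of 1 "- _"] by (simp add: nn_integral_cmult nn_integral_multc)
  also have "ennreal (1 / 2) * ((\<integral>\<^sup>+r. P r \<partial>lborel) * ennreal (2 * pi) + (\<integral>\<^sup>+r. P r \<partial>lborel) * ennreal (2 * pi))
      = ennreal (2 * pi) * (\<integral>\<^sup>+r. P r \<partial>lborel)"
  proof -
    have "ennreal (1 / 2) * (y + y) = y" for y :: ennreal
    proof -
      have "ennreal (1 / 2) * (y + y) = (ennreal (1 / 2) * 2) * y" by (simp add: mult_2 algebra_simps)
      also have "ennreal (1 / 2) * 2 = 1"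
        using ennreal_mult'[of "1/2" 2] by simp
      finally show ?thesis by simp
    qed
    from this[of "(\<integral>\<^sup>+r. P r \<partial>lborel) * ennreal (2 * pi)"]
    show ?thesis by (simp only: mult.commute[of "ennreal (2 * pi)"])
  qed
  finally show ?thesis unfolding w_def g_def P_def .
qed

text \<open>
  The weight of the previous lemma tends to \<open>1\<close> as its width grows, while the bound does not
  depend on the width.
\<close>
lemma plancherel_le:
  assumes psi: "integrable lborel \<psi>"
  shows "(\<integral>\<^sup>+x. ennreal ((norm (fourier (-1) \<psi> x))\<^sup>2) \<partial>lborel)
    \<le> ennreal (2 * pi) * (\<integral>\<^sup>+t. ennreal ((norm (\<psi> t))\<^sup>2) \<partial>lborel)"
proof (rule nn_integral_le_limit)
  have pm [measurable]: "\<psi> \<in> borel_measurable borel" using psi by auto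
  show "(\<lambda>x. ennreal (exp (- (x / real (Suc i))\<^sup>2 / 2) * (norm (fourier (-1) \<psi> x))\<^sup>2)) \<in> borel_measurable lborel" for i
    by measurable
  have "(\<lambda>i. exp (- (x / real (Suc i))\<^sup>2 / 2)) \<longlonglongrightarrow> exp (- 0\<^sup>2 / 2)" for x
    by (intro tendsto_intros LIMSEQ_Suc[OF lim_const_over_n]) auto
  then have "(\<lambda>i. exp (- (x / real (Suc i))\<^sup>2 / 2) * (norm (fourier (-1) \<psi> x))\<^sup>2) \<longlonglongrightarrow> 1 * (norm (fourier (-1) \<psi> x))\<^sup>2" for x
    by (intro tendsto_mult tendsto_const) simp
  then show "AE x in lborel. (\<lambda>i. ennreal (exp (- (x / real (Suc i))\<^sup>2 / 2) * (norm (fourier (-1) \<psi> x))\<^sup>2))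
      \<longlonglongrightarrow> ennreal ((norm (fourier (-1) \<psi> x))\<^sup>2)"
    by (intro AE_I2 tendsto_ennrealI) simp
  show "\<forall>\<^sub>F i in sequentially. (\<integral>\<^sup>+x. ennreal (exp (- (x / real (Suc i))\<^sup>2 / 2) * (norm (fourier (-1) \<psi> x))\<^sup>2) \<partial>lborel)
      \<le> ennreal (2 * pi) * (\<integral>\<^sup>+t. ennreal ((norm (\<psi> t))\<^sup>2) \<partial>lborel)"
    using plancherel_le_gaussian_weight[OF psi] by (intro always_eventually allI) simp
qed simp

section \<open>Bounded variation and the decay of the Fourier transform\<close>

lemma total_variation_leI:
  assumes "\<And>N t. mono t \<Longrightarrow> (\<Sum>i<(N::nat). \<bar>g (t (Suc i)) - g (t i)\<bar>) \<le> C"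
  shows "total_variation g \<le> ennreal C"
  unfolding total_variation_def using assms by (auto intro!: SUP_least ennreal_leI)

lemma total_variation_leD:
  assumes "total_variation g \<le> ennreal C" "C \<ge> 0" "mono t"
  shows "(\<Sum>i<(N::nat). \<bar>g (t (Suc i)) - g (t i)\<bar>) \<le> C"
proof -
  have "ennreal (\<Sum>i<N. \<bar>g (t (Suc i)) - g (t i)\<bar>) \<le> total_variation g"
    unfolding total_variation_def using assms(3) by (intro SUP_upper2[of "(N, t)"]) auto
  with assms(1) have "ennreal (\<Sum>i<N. \<bar>g (t (Suc i)) - g (t i)\<bar>) \<le> ennreal C"
    by (rule order_trans[rotated])
  with assms(2) show ?thesis by simp
qed

definition fwd_diff :: "real \<Rightarrow> (real \<Rightarrow> 'a::minus) \<Rightarrow> real \<Rightarrow> 'a" where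
  "fwd_diff s g x = g (x + s) - g x"

text \<open>
  For fixed partition points and signs \<open>\<sigma> i\<close>, the signed sum \<open>H u\<close> of the increments of
  \<open>g (\<cdot> + u)\<close> is differentiable in \<open>u\<close>, and \<open>H s - H 0\<close> is the variation sum of the difference.
  The mean value theorem turns it into \<open>s\<close> times a signed variation sum of the derivative.
\<close>
lemma total_variation_fwd_diff:
  assumes g: "\<And>x. g differentiable (at x)"
    and C: "total_variation (deriv g) \<le> ennreal C" "C \<ge> 0" and s: "s > 0"
  shows "total_variation (fwd_diff s g) \<le> ennreal (s * C)"
proof (rule total_variation_leI)
  fix N :: nat and t :: "nat \<Rightarrow> real" assume t: "mono t"
  define \<sigma> where "\<sigma> i = sgn (fwd_diff s g (t (Suc i)) - fwd_diff s g (t i))" for i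
  define H where "H u = (\<Sum>i<N. \<sigma> i * (g (t (Suc i) + u) - g (t i + u)))" for u
  define H' where "H' u = (\<Sum>i<N. \<sigma> i * (deriv g (t (Suc i) + u) - deriv g (t i + u)))" for u
  have D: "(g has_real_derivative deriv g x) (at x)" for x
    using g[of x] by (simp add: DERIV_deriv_iff_real_differentiable)
  have sh: "((\<lambda>u. g (c + u)) has_real_derivative deriv g (c + u)) (at u)" for c u
    using D[of "u + c"] DERIV_shift[of g "deriv g (c + u)" u c] by (simp add: add.commute)
  have "(H has_real_derivative H' u) (at u)" for u
    unfolding H_def H'_def by (intro DERIV_sum DERIV_cmult DERIV_diff sh)
  then obtain z where "0 < z" "z < s" and z: "H s - H 0 = (s - 0) * H' z"
    using MVT2[of 0 s H H'] s by auto
  have sgn1: "\<sigma> i * d \<le> \<bar>d\<bar>" for i d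
    by (auto simp: \<sigma>_def sgn_if)
  have "H' z \<le> (\<Sum>i<N. \<bar>deriv g (t (Suc i) + z) - deriv g (t i + z)\<bar>)"
    unfolding H'_def by (intro sum_mono sgn1)
  also have "\<dots> \<le> C"
    using t by (intro total_variation_leD[OF C, of "\<lambda>i. t i + z"]) (auto simp: mono_def)
  finally have "H s - H 0 \<le> s * C"
    unfolding z using s by simp
  moreover have "(\<Sum>i<N. \<bar>fwd_diff s g (t (Suc i)) - fwd_diff s g (t i)\<bar>) = H s - H 0"
    unfolding H_def sum_subtractf[symmetric]
    by (intro sum.cong refl) (auto simp: \<sigma>_def fwd_diff_def abs_sgn algebra_simps)
  ultimately show "(\<Sum>i<N. \<bar>fwd_diff s g (t (Suc i)) - fwd_diff s g (t i)\<bar>) \<le> s * C"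
    by simp
qed

lemma DERIV_fwd_diff_iter:
  assumes g: "\<And>x. g differentiable (at x)"
  shows "((fwd_diff s ^^ k) g has_real_derivative (fwd_diff s ^^ k) (deriv g) x) (at x)"
proof (induction k arbitrary: x)
  case 0
  then show ?case using g[of x] by (simp add: DERIV_deriv_iff_real_differentiable)
next
  case (Suc k)
  have e: "(fwd_diff s ^^ Suc k) u = (\<lambda>x. (fwd_diff s ^^ k) u (x + s) - (fwd_diff s ^^ k) u x)" for u :: "real \<Rightarrow> real"
    by (auto simp: fwd_diff_def)
  show ?case unfolding e
    by (intro DERIV_diff Suc.IH DERIV_shift[THEN iffD1])
qed

text \<open>
  Differencing commutes with differentiation, so each difference can be traded for one derivative and
  a factor \<open>s\<close>.
\<close>
lemma total_variation_fwd_diff_iter: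
  assumes "times_differentiable k g" "total_variation ((deriv ^^ k) g) \<le> ennreal C" "C \<ge> 0" "s > 0"
  shows "total_variation ((fwd_diff s ^^ k) g) \<le> ennreal (s ^ k * C)"
  using assms
proof (induction k arbitrary: g)
  case 0
  then show ?case by simp
next
  case (Suc k)
  have sw: "(deriv ^^ Suc j) g = (deriv ^^ j) (deriv g)" for j
    by (simp only: funpow_Suc_right comp_apply)
  have g: "g differentiable (at x)" for x
    using Suc.prems(1) unfolding times_differentiable_def by (metis funpow_0 zero_less_Suc)
  have "times_differentiable k (deriv g)"
    using Suc.prems(1) unfolding times_differentiable_def
    by (metis Suc_less_eq sw)
  then have IH: "total_variation ((fwd_diff s ^^ k) (deriv g)) \<le> ennreal (s ^ k * C)"
    using Suc.prems by (intro Suc.IH) (simp_all only: sw)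
  note d = DERIV_fwd_diff_iter[OF g, of k s]
  have "deriv ((fwd_diff s ^^ k) g) = (fwd_diff s ^^ k) (deriv g)"
    by (intro ext DERIV_imp_deriv d)
  moreover have "(fwd_diff s ^^ k) g differentiable (at x)" for x
    using d real_differentiable_def by blast
  ultimately have "total_variation (fwd_diff s ((fwd_diff s ^^ k) g)) \<le> ennreal (s * (s ^ k * C))"
    using IH Suc.prems by (intro total_variation_fwd_diff) auto
  then show ?case by (simp only: funpow.simps comp_apply power_Suc mult.assoc)
qed

text \<open>
  By translation invariance, \<open>N\<close> adjacent intervals of length \<open>s\<close> can be folded onto one. The point is
  that the integrand then becomes a sum along an arithmetic progression.
\<close>
lemma nn_integral_fold_translates:
  assumes [measurable]: "F \<in> borel_measurable borel" and s: "s > 0"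
  shows "(\<integral>\<^sup>+x. F x * indicator {a..<a + real N * s} x \<partial>lborel)
    = (\<integral>\<^sup>+x. (\<Sum>k<N. F (a + real k * s + x)) * indicator {0..<s} x \<partial>lborel)"
proof (induction N)
  case 0
  then show ?case by simp
next
  case (Suc N)
  have "(\<integral>\<^sup>+x. F x * indicator {a..<a + real (Suc N) * s} x \<partial>lborel)
    = (\<integral>\<^sup>+x. F x * indicator {a..<a + real N * s} x + F x * indicator {a + real N * s..<a + real (Suc N) * s} x \<partial>lborel)"
  proof (intro nn_integral_cong)
    fix x
    define q where "q = real N * s"
    have q: "0 \<le> q" "real (Suc N) * s = q + s" using s by (auto simp: q_def algebra_simps)
    show "F x * indicator {a..<a + real (Suc N) * s} x
      = F x * indicator {a..<a + real N * s} x + F x * indicator {a + real N * s..<a + real (Suc N) * s} x"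
      unfolding q(2) q_def[symmetric] using s q(1) by (auto simp: indicator_def)
  qed
  also have "\<dots> = (\<integral>\<^sup>+x. F x * indicator {a..<a + real N * s} x \<partial>lborel)
      + (\<integral>\<^sup>+x. F x * indicator {a + real N * s..<a + real (Suc N) * s} x \<partial>lborel)"
    by (rule nn_integral_add) measurable
  also have "(\<integral>\<^sup>+x. F x * indicator {a + real N * s..<a + real (Suc N) * s} x \<partial>lborel)
    = (\<integral>\<^sup>+x. F (a + real N * s + x) * indicator {0..<s} x \<partial>lborel)"
    by (subst nn_integral_real_affine[where c=1 and t="a + real N * s"])
       (auto simp: indicator_def algebra_simps intro!: nn_integral_cong)
  finally show ?case
    unfolding Suc.IH by (subst (asm) nn_integral_add[symmetric]) (auto simp: algebra_simps)
qed

text \<open>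
  After folding the line onto one interval of length \<open>s\<close>, the integrand at each point is a
  variation sum of \<open>g\<close> over an arithmetic progression with step \<open>s\<close>.
\<close>
lemma nn_integral_fwd_diff_le:
  assumes [measurable]: "g \<in> borel_measurable borel"
    and C: "total_variation g \<le> ennreal C" "C \<ge> 0" and s: "s > 0"
  shows "(\<integral>\<^sup>+x. ennreal \<bar>fwd_diff s g x\<bar> \<partial>lborel) \<le> ennreal (s * C)"
proof (rule nn_integral_le_limit)
  have [measurable]: "fwd_diff s g \<in> borel_measurable borel"
    unfolding fwd_diff_def by measurable
  \<comment> \<open>The windows from \<open>- n * s\<close> to \<open>n * s\<close> consist of \<open>2 * n\<close> steps and exhaust the line.\<close>
  define a where "a n = - (real n * s)" for n
  show "(\<lambda>x. ennreal \<bar>fwd_diff s g x\<bar> * indicator {a n..<a n + real (2 * n) * s} x) \<in> borel_measurable lborel" for n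
    by measurable
  have "(\<integral>\<^sup>+x. ennreal \<bar>fwd_diff s g x\<bar> * indicator {a n..<a n + real (2 * n) * s} x \<partial>lborel) \<le> ennreal (s * C)" for n
  proof -
    have "(\<integral>\<^sup>+x. ennreal \<bar>fwd_diff s g x\<bar> * indicator {a n..<a n + real (2 * n) * s} x \<partial>lborel)
        = (\<integral>\<^sup>+x. (\<Sum>k<2*n. ennreal \<bar>fwd_diff s g (a n + real k * s + x)\<bar>) * indicator {0..<s} x \<partial>lborel)"
      using s by (intro nn_integral_fold_translates) measurable
    also have "\<dots> \<le> (\<integral>\<^sup>+x. ennreal C * indicator {0..<s} x \<partial>lborel)"
    proof (intro nn_integral_mono mult_right_mono)
      fix x
      have "(\<Sum>k<2*n. \<bar>g (a n + real (Suc k) * s + x) - g (a n + real k * s + x)\<bar>) \<le> C"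
        using s by (intro total_variation_leD[OF C, of "\<lambda>k. a n + real k * s + x"])
          (auto simp: mono_def mult_right_mono)
      then show "(\<Sum>k<2*n. ennreal \<bar>fwd_diff s g (a n + real k * s + x)\<bar>) \<le> ennreal C"
        by (subst sum_ennreal) (auto simp: fwd_diff_def algebra_simps intro: ennreal_leI)
    qed simp
    also have "\<dots> = ennreal (s * C)"
      using s C by (simp add: nn_integral_cmult ennreal_mult'' mult.commute)
    finally show ?thesis .
  qed
  then show "\<forall>\<^sub>F n in sequentially. (\<integral>\<^sup>+x. ennreal \<bar>fwd_diff s g x\<bar> * indicator {a n..<a n + real (2 * n) * s} x \<partial>lborel) \<le> ennreal (s * C)"
    by simp
  have "(\<lambda>n. ennreal \<bar>fwd_diff s g x\<bar> * indicator {a n..<a n + real (2 * n) * s} x) \<longlonglongrightarrow> ennreal \<bar>fwd_diff s g x\<bar>" for x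
  proof (rule tendsto_eventually)
    obtain n0 :: nat where n0: "\<bar>x\<bar> / s < real n0" using reals_Archimedean2 by blast
    show "\<forall>\<^sub>F n in sequentially. ennreal \<bar>fwd_diff s g x\<bar> * indicator {a n..<a n + real (2 * n) * s} x = ennreal \<bar>fwd_diff s g x\<bar>"
      using eventually_ge_at_top[of n0]
    proof eventually_elim
      case (elim n)
      then have "\<bar>x\<bar> / s < real n" using n0 by linarith
      then have "\<bar>x\<bar> < real n * s" using s by (simp add: field_simps)
      then show ?case by (auto simp: indicator_def a_def mult.commute)
    qed
  qed
  then show "AE x in lborel. (\<lambda>n. ennreal \<bar>fwd_diff s g x\<bar> * indicator {a n..<a n + real (2 * n) * s} x) \<longlonglongrightarrow> ennreal \<bar>fwd_diff s g x\<bar>"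
    by simp
qed simp

lemma integrable_fwd_diff:
  fixes g :: "real \<Rightarrow> 'a::{banach, second_countable_topology}"
  assumes "integrable lborel g"
  shows "integrable lborel (fwd_diff s g)"
  unfolding fwd_diff_def
  using lborel_integrable_real_affine[OF assms, of 1 s] assms
  by (intro Bochner_Integration.integrable_diff) (simp_all add: add.commute)

lemma fourier_fwd_diff:
  assumes g: "integrable lborel g"
  shows "fourier 1 (fwd_diff s g) t = (iexp (- (s * t)) - 1) * fourier 1 g t"
proof -
  have i1: "integrable lborel (\<lambda>x. iexp (t * x) * g x)" by (rule integrable_iexp_mult[OF g])
  have i2: "integrable lborel (\<lambda>x. iexp (t * x) * g (s + 1 * x))"
    by (intro integrable_iexp_mult lborel_integrable_real_affine[OF g]) simp
  have sh: "iexp (t * x) * g (s + 1 * x) = iexp (- (s * t)) * (iexp (t * (s + 1 * x)) * g (s + 1 * x))" for x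
    by (simp add: distrib_left exp_add exp_minus mult_ac)
  have "fourier 1 (fwd_diff s g) t = (LINT x|lborel. iexp (t * x) * g (s + 1 * x) - iexp (t * x) * g x)"
    unfolding fourier_def fwd_diff_def by (simp add: algebra_simps)
  also have "\<dots> = (LINT x|lborel. iexp (t * x) * g (s + 1 * x)) - (LINT x|lborel. iexp (t * x) * g x)"
    by (rule Bochner_Integration.integral_diff[OF i2 i1])
  also have "(LINT x|lborel. iexp (t * x) * g x) = fourier 1 g t"
    unfolding fourier_def by (simp add: mult_ac)
  also have "(LINT x|lborel. iexp (t * x) * g (s + 1 * x))
    = (LINT x|lborel. iexp (- (s * t)) * (iexp (t * (s + 1 * x)) * g (s + 1 * x)))"
    unfolding sh ..
  also have "\<dots> = iexp (- (s * t)) * (LINT x|lborel. iexp (t * (s + 1 * x)) * g (s + 1 * x))"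
    by (rule integral_mult_right_zero)
  also have "(LINT x|lborel. iexp (t * (s + 1 * x)) * g (s + 1 * x)) = fourier 1 g t"
    unfolding fourier_def by (subst (2) lborel_integral_real_affine[of 1 _ s]) (auto simp: mult_ac)
  finally show ?thesis by (simp add: algebra_simps)
qed

lemma fourier_fwd_diff_iter:
  assumes g: "integrable lborel g"
  shows "fourier 1 ((fwd_diff s ^^ k) g) t = (iexp (- (s * t)) - 1) ^ k * fourier 1 g t"
    and "integrable lborel ((fwd_diff s ^^ k) g)"
proof -
  have "integrable lborel ((fwd_diff s ^^ k) g) \<and> fourier 1 ((fwd_diff s ^^ k) g) t = (iexp (- (s * t)) - 1) ^ k * fourier 1 g t"
    by (induction k) (auto simp: g integrable_fwd_diff fourier_fwd_diff)
  then show "fourier 1 ((fwd_diff s ^^ k) g) t = (iexp (- (s * t)) - 1) ^ k * fourier 1 g t"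
    "integrable lborel ((fwd_diff s ^^ k) g)" by auto
qed

lemma fwd_diff_iter_of_real:
  "(fwd_diff s ^^ k) (\<lambda>x. complex_of_real (g x)) = (\<lambda>x. complex_of_real ((fwd_diff s ^^ k) g x))"
  by (induction k) (auto simp: fwd_diff_def)

lemma fwd_diff_iter_measurable:
  fixes g :: "real \<Rightarrow> real"
  assumes "g \<in> borel_measurable borel"
  shows "(fwd_diff s ^^ k) g \<in> borel_measurable borel"
proof (induction k)
  case 0 then show ?case using assms by simp
next
  case (Suc k)
  note [measurable] = Suc
  have "(fwd_diff s ^^ Suc k) g = (\<lambda>x. (fwd_diff s ^^ k) g (x + s) - (fwd_diff s ^^ k) g x)"
    by (auto simp: fwd_diff_def)
  then show ?case by simp
qed

text \<open>
  A function with an \<open>m\<close>-th derivative of bounded variation has \<open>(m + 1)\<close>-fold differences of step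
  \<open>s\<close> whose \<open>L\<^sup>1\<close> norm is at most \<open>s ^ (m + 1) * V\<close>, and differencing multiplies the transform by
  \<open>iexp (- (s * t)) - 1\<close>, which is \<open>- \<i> * s * t\<close> to first order. Dividing by \<open>s ^ (m + 1)\<close> and letting
  \<open>s\<close> tend to \<open>0\<close> gives the decay. Differences replace integration by parts, for which the
  intermediate derivatives would have to be integrable.
\<close>
lemma fourier_decay:
  fixes f :: "real \<Rightarrow> real"
  assumes f: "integrable lborel f" and m: "times_differentiable m f"
    and V: "total_variation ((deriv ^^ m) f) \<le> ennreal V" "V \<ge> 0"
  shows "norm (fourier 1 (\<lambda>x. complex_of_real (f x)) t) * \<bar>t\<bar> ^ (m + 1) \<le> V"
proof -
  define \<phi> where "\<phi> = fourier 1 (\<lambda>x. complex_of_real (f x)) t"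
  have fm: "f \<in> borel_measurable borel" using f by auto
  have fi: "integrable lborel (\<lambda>x. complex_of_real (f x))" using f by simp
  have b: "norm \<phi> * (norm (iexp (- (s * t)) - 1) / s) ^ (m + 1) \<le> V" if s: "s > 0" for s
  proof -
    define g where "g = (fwd_diff s ^^ m) f"
    have "(norm (iexp (- (s * t)) - 1)) ^ (m + 1) * norm \<phi>
        = norm (fourier 1 ((fwd_diff s ^^ (m + 1)) (\<lambda>x. complex_of_real (f x))) t)"
      unfolding fourier_fwd_diff_iter(1)[OF fi] by (simp add: \<phi>_def norm_mult norm_power)
    also have "\<dots> \<le> (LINT x|lborel. \<bar>fwd_diff s g x\<bar>)"
    proof -
      have "cmod (fwd_diff s (\<lambda>x. complex_of_real (g x)) x) = \<bar>fwd_diff s g x\<bar>" for x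
        unfolding fwd_diff_def of_real_diff[symmetric] norm_of_real ..
      then show ?thesis
        by (intro order_trans[OF norm_fourier_le]) (simp add: fwd_diff_iter_of_real g_def)
    qed
    also have "ennreal \<dots> = (\<integral>\<^sup>+x. ennreal \<bar>fwd_diff s g x\<bar> \<partial>lborel)"
    proof (rule nn_integral_eq_integral[symmetric])
      have "integrable lborel (fwd_diff s ((fwd_diff s ^^ m) f))"
      proof (rule integrable_fwd_diff)
        show "integrable lborel ((fwd_diff s ^^ m) f)"
          by (induction m) (auto intro: f integrable_fwd_diff)
      qed
      then show "integrable lborel (\<lambda>x. \<bar>fwd_diff s g x\<bar>)" unfolding g_def by (rule integrable_abs)
    qed simp
    also have "\<dots> \<le> ennreal (s * (s ^ m * V))"
      unfolding g_def using s V
      by (intro nn_integral_fwd_diff_le fwd_diff_iter_measurable fm total_variation_fwd_diff_iter m) auto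
    finally have "(norm (iexp (- (s * t)) - 1)) ^ (m + 1) * norm \<phi> \<le> s * (s ^ m * V)"
      using s V by (simp add: ennreal_leI)
    then show ?thesis using s by (simp add: power_divide field_simps)
  qed
  \<comment> \<open>The quotient is a difference quotient at \<open>0\<close> of \<open>exp (- \<i> * t * z)\<close>, restricted to positive reals.\<close>
  have lim: "((\<lambda>s. norm ((iexp (- (s * t)) - 1) / s)) \<longlongrightarrow> \<bar>t\<bar>) (at_right 0)"
  proof -
    have "((\<lambda>z. exp (- \<i> * t * z)) has_field_derivative (- \<i> * t)) (at 0)"
      by (auto intro!: derivative_eq_intros)
    then have "((\<lambda>z. (exp (- \<i> * t * z) - 1) / z) \<longlongrightarrow> - \<i> * t) (at 0)"
      by (simp add: DERIV_def)
    moreover have "filterlim complex_of_real (at 0) (at_right (0::real))"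
      by (intro filterlim_atI tendsto_eq_intros) (auto intro!: eventually_at_rightI[of 0 1])
    ultimately have "((\<lambda>s. (exp (- \<i> * t * complex_of_real s) - 1) / complex_of_real s) \<longlongrightarrow> - \<i> * t) (at_right 0)"
      by (rule filterlim_compose)
    from tendsto_norm[OF this] show ?thesis by (simp add: norm_mult mult_ac)
  qed
  have "((\<lambda>s. norm \<phi> * (norm ((iexp (- (s * t)) - 1) / s)) ^ (m + 1)) \<longlongrightarrow> norm \<phi> * \<bar>t\<bar> ^ (m + 1)) (at_right 0)"
    by (intro tendsto_intros lim)
  then show ?thesis unfolding \<phi>_def[symmetric]
    by (rule tendsto_upperbound) (use b in \<open>auto simp: norm_divide eventually_at_right_less intro!: eventually_at_rightI[of 0 1]\<close>)
qed

section \<open>The sinc kernel\<close>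

text \<open>
  The kernel whose average over the sample is the sinc estimator. The value at \<open>0\<close> is the limit,
  and \<open>1 / pi\<close> makes its Fourier transform the indicator of the frequency band \<open>\<bar>t\<bar> \<le> 1 / h\<close>.
\<close>
definition sinc_kernel :: "real \<Rightarrow> real \<Rightarrow> real" where
  "sinc_kernel h u = (if u = 0 then 1 / h else sin (u / h) / u) / pi"

lemma sinc_kernel_measurable [measurable]: "sinc_kernel h \<in> borel_measurable borel"
  unfolding sinc_kernel_def by measurable

lemma integrable_indicator_Icc:
  "integrable lborel (indicator {a..b::real} :: real \<Rightarrow> real)"
  by (intro integrable_real_indicator) (auto simp: emeasure_lborel_Icc_eq)

text \<open>
  The antiderivative of \<open>iexp (- (t * u))\<close> in \<open>t\<close> is explicit for \<open>u \<noteq> 0\<close>; at \<open>u = 0\<close> the integral is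
  the length of the band.
\<close>
lemma fourier_indicator:
  assumes h: "h > 0"
  shows "fourier (-1) (\<lambda>t. complex_of_real (indicator {- (1/h)..1/h} t)) u = complex_of_real (2 * pi * sinc_kernel h u)"
proof (cases "u = 0")
  case True
  have "fourier (-1) (\<lambda>t. complex_of_real (indicator {- (1/h)..1/h} t)) u = complex_of_real (LINT t|lborel. indicator {- (1/h)..1/h} t)"
    unfolding fourier_def True by (simp add: integrable_indicator_Icc)
  also have "(LINT t|lborel. indicator {- (1/h)..1/h} t) = 2 / h"
    using h by simp
  finally show ?thesis using True h by (simp add: sinc_kernel_def)
next
  case False
  have sc: "sin (complex_of_real u / complex_of_real h) = complex_of_real (sin (u / h))"
    by (metis of_real_divide sin_of_real)
  define F where "F t = iexp (- (t * u)) / (- \<i> * u)" for t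
  have "has_bochner_integral lborel (\<lambda>t. indicator {- (1/h)..1/h} t *\<^sub>R iexp (- (t * u))) (F (1/h) - F (- (1/h)))"
  proof (rule has_bochner_integral_FTC_Icc)
    show "- (1/h) \<le> 1/h" using h by simp
    have d: "((\<lambda>t. exp (t *\<^sub>R (- \<i> * u))) has_vector_derivative exp (t *\<^sub>R (- \<i> * u)) * (- \<i> * u)) (at t within {- (1/h)..1/h})" for t
      by (rule exp_scaleR_has_vector_derivative_right)
    have "((\<lambda>t. exp (t *\<^sub>R (- \<i> * u)) / (- \<i> * u)) has_vector_derivative exp (t *\<^sub>R (- \<i> * u)) * (- \<i> * u) / (- \<i> * u)) (at t within {- (1/h)..1/h})" for t
      by (rule has_vector_derivative_divide[OF d])
    then show "(F has_vector_derivative iexp (- (t * u))) (at t within {- (1/h)..1/h})" for t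
      unfolding F_def using False by (simp add: scaleR_conv_of_real mult_ac)
    show "continuous_on {- (1/h)..1/h} (\<lambda>t. iexp (- (t * u)))"
      by (intro continuous_intros)
  qed
  then have "(LINT t|lborel. indicator {- (1/h)..1/h} t *\<^sub>R iexp (- (t * u))) = F (1/h) - F (- (1/h))"
    by (rule has_bochner_integral_integral_eq)
  then have "fourier (-1) (\<lambda>t. complex_of_real (indicator {- (1/h)..1/h} t)) u = F (1/h) - F (- (1/h))"
    unfolding fourier_def by (simp add: scaleR_conv_of_real mult_ac)
  also have "\<dots> = complex_of_real (2 * sin (u / h) / u)"
    using False sc unfolding F_def exp_Euler
    by (simp add: complex_eq_iff Re_divide Im_divide power2_eq_square field_simps cos_of_real sin_of_real)
  finally show ?thesis using False by (simp add: sinc_kernel_def)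
qed

text \<open>
  Plancherel's inequality for the indicator of the band, which has length \<open>2 / h\<close>.
\<close>
lemma sinc_kernel_square_integral:
  assumes h: "h > 0"
  shows "(\<integral>\<^sup>+u. ennreal ((sinc_kernel h u)\<^sup>2) \<partial>lborel) \<le> ennreal (1 / (pi * h))"
proof -
  have "(\<integral>\<^sup>+u. ennreal ((sinc_kernel h u)\<^sup>2) \<partial>lborel)
      = ennreal (1 / (2 * pi)\<^sup>2) * (\<integral>\<^sup>+u. ennreal ((norm (fourier (-1) (\<lambda>t. complex_of_real (indicator {- (1/h)..1/h} t)) u))\<^sup>2) \<partial>lborel)"
    unfolding fourier_indicator[OF h]
    by (subst nn_integral_cmult[symmetric])
       (auto simp: fourier_indicator[OF h] norm_mult power_mult_distrib simp flip: ennreal_mult' intro!: nn_integral_cong)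
  also have "\<dots> \<le> ennreal (1 / (2 * pi)\<^sup>2) * (ennreal (2 * pi) * (\<integral>\<^sup>+t. ennreal ((norm (complex_of_real (indicator {- (1/h)..1/h} t)))\<^sup>2) \<partial>lborel))"
    by (intro mult_left_mono plancherel_le) (simp_all add: integrable_indicator_Icc)
  also have "(\<integral>\<^sup>+t. ennreal ((norm (complex_of_real (indicator {- (1/h)..1/h} t)))\<^sup>2) \<partial>lborel) = (\<integral>\<^sup>+t. indicator {- (1/h)..1/h} t \<partial>lborel)"
    by (intro nn_integral_cong) (auto simp: indicator_def)
  also have "\<dots> = ennreal (2 / h)" using h by simp
  also have "ennreal (1 / (2 * pi)\<^sup>2) * (ennreal (2 * pi) * ennreal (2 / h)) = ennreal (1 / (pi * h))"
    using h by (simp add: power2_eq_square field_simps flip: ennreal_mult')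
  finally show ?thesis .
qed

lemma abs_sinc_kernel_le:
  assumes "h > 0"
  shows "\<bar>sinc_kernel h u\<bar> \<le> 1 / (pi * h)"
proof (cases "u = 0")
  case False
  have "\<bar>sin (u / h)\<bar> \<le> \<bar>u\<bar> / h" using abs_sin_x_le_abs_x[of "u / h"] assms by simp
  then have "\<bar>sin (u / h)\<bar> / \<bar>u\<bar> \<le> 1 / h" using False assms by (simp add: field_simps)
  then show ?thesis using False by (simp add: sinc_kernel_def abs_mult field_simps)
qed (use assms in \<open>simp add: sinc_kernel_def mult.commute\<close>)

text \<open>
  With \<open>a = 1 / h\<close> this integrates the square of the decay estimate over the frequencies outside the
  band. The integrand is even, so the two halves contribute equally.
\<close>
lemma tail_integral:
  assumes a: "a > 0"
  shows "(\<integral>\<^sup>+t. ennreal (C\<^sup>2 / \<bar>t\<bar> ^ (2 * m + 2)) * indicator {t. \<bar>t\<bar> \<ge> a} t \<partial>lborel)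
    \<le> ennreal (2 * (C\<^sup>2 / (real (2 * m + 1) * a ^ (2 * m + 1))))"
proof -
  define I where "I t = ennreal (C\<^sup>2 / t ^ (2 * m + 2)) * indicator {a..} t" for t
  have [measurable]: "I \<in> borel_measurable borel" unfolding I_def by measurable
  define F where "F t = - (C\<^sup>2 / (real (2 * m + 1) * t ^ (2 * m + 1)))" for t :: real
  have I: "integral\<^sup>N lborel I = ennreal (0 - F a)"
    unfolding I_def
  proof (rule nn_integral_FTC_atLeast)
    fix t assume "a \<le> t"
    with a have t: "t > 0" by simp
    have "((\<lambda>t. - (C\<^sup>2 / real (2 * m + 1)) * inverse (t ^ (2 * m + 1))) has_real_derivative
       (- (C\<^sup>2 / real (2 * m + 1)) * (- (inverse (t ^ (2 * m + 1)) * (real (2 * m + 1) * t ^ (2 * m)) * inverse (t ^ (2 * m + 1)))))) (at t)"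
      using t by (intro DERIV_cmult DERIV_inverse' derivative_eq_intros) auto
    moreover have "- (C\<^sup>2 / real (2 * m + 1)) * (- (inverse (t ^ (2 * m + 1)) * (real (2 * m + 1) * t ^ (2 * m)) * inverse (t ^ (2 * m + 1))))
        = C\<^sup>2 / t ^ (2 * m + 2)"
    proof -
      define N p where "N = real (2 * m + 1)" and "p = t ^ (2 * m)"
      have "N > 0" "p > 0" using t by (auto simp: N_def p_def)
      moreover have "t ^ (2 * m + 1) = t * p" "t ^ (2 * m + 2) = t * t * p"
        by (simp_all add: p_def)
      ultimately show ?thesis
        using t unfolding N_def[symmetric] p_def[symmetric] by (simp add: field_simps)
    qed
    moreover have "F = (\<lambda>t. - (C\<^sup>2 / real (2 * m + 1)) * inverse (t ^ (2 * m + 1)))"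
      unfolding F_def by (simp add: divide_inverse mult.assoc)
    ultimately show "(F has_real_derivative C\<^sup>2 / t ^ (2 * m + 2)) (at t)" by simp
    show "0 \<le> C\<^sup>2 / t ^ (2 * m + 2)" using t by simp
  next
    show "(F \<longlongrightarrow> 0) at_top" unfolding F_def by real_asymp
  qed measurable
  have "(\<integral>\<^sup>+t. ennreal (C\<^sup>2 / \<bar>t\<bar> ^ (2 * m + 2)) * indicator {t. \<bar>t\<bar> \<ge> a} t \<partial>lborel)
    \<le> (\<integral>\<^sup>+t. I t + I (0 + -1 * t) \<partial>lborel)"
    by (intro nn_integral_mono) (auto simp: I_def indicator_def abs_if)
  also have "\<dots> = integral\<^sup>N lborel I + (\<integral>\<^sup>+t. I (0 + -1 * t) \<partial>lborel)"
    by (rule nn_integral_add) measurable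
  also have "(\<integral>\<^sup>+t. I (0 + -1 * t) \<partial>lborel) = integral\<^sup>N lborel I"
    using nn_integral_real_affine[of I "-1" 0] by simp
  also have "integral\<^sup>N lborel I + integral\<^sup>N lborel I = ennreal (2 * (C\<^sup>2 / (real (2 * m + 1) * a ^ (2 * m + 1))))"
    unfolding I using a by (subst ennreal_plus[symmetric]) (auto simp: F_def)
  finally show ?thesis .
qed

section \<open>Probability densities and Fourier inversion\<close>

locale density_function =
  fixes f :: "real \<Rightarrow> real"
  assumes f_measurable [measurable]: "f \<in> borel_measurable borel"
    and f_nonneg: "f x \<ge> 0"
    and f_total: "(\<integral>\<^sup>+x. ennreal (f x) \<partial>lborel) = 1"
begin

definition \<phi> :: "real \<Rightarrow> complex" where
  "\<phi> = fourier 1 (\<lambda>x. complex_of_real (f x))"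

lemma f_integrable: "integrable lborel f"
  using f_nonneg f_total by (intro integrableI_nonneg) auto

lemma \<phi>_measurable [measurable]: "\<phi> \<in> borel_measurable borel"
  unfolding \<phi>_def by measurable

lemma norm_\<phi>_le: "norm (\<phi> t) \<le> 1"
proof -
  have "(LINT x|lborel. f x) = 1"
    using f_nonneg f_total by (subst integral_eq_nn_integral) auto
  then show ?thesis
    using norm_fourier_le[of 1 "\<lambda>x. complex_of_real (f x)" t] f_nonneg by (simp add: \<phi>_def)
qed

sublocale density: real_distribution "density lborel f"
proof -
  show "real_distribution (density lborel f)"
    unfolding real_distribution_def real_distribution_axioms_def
    using f_total by (auto intro!: prob_spaceI simp: emeasure_density)
qed

lemma char_density: "char (density lborel f) = \<phi>"
  unfolding char_def \<phi>_def fourier_def using f_nonneg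
  by (subst integral_density) (auto simp: scaleR_conv_of_real mult_ac)

text \<open>
  Truncated to a bounded band, a bounded multiple of the characteristic function is integrable;
  without truncation \<open>\<phi>\<close> may fail to be integrable, which is why all inversions below use bands.
\<close>
lemma integrable_band_limited:
  assumes [measurable]: "q \<in> borel_measurable borel" and q: "\<And>t. norm (q t) \<le> B" and [measurable]: "S \<in> sets borel"
    and S: "S \<subseteq> {a..b}"
  shows "integrable lborel (\<lambda>t. complex_of_real (indicator S t) * q t * \<phi> t)"
proof (rule Bochner_Integration.integrable_bound[of _ "\<lambda>t. B * indicator {a..b} t"])
  show "AE t in lborel. norm (complex_of_real (indicator S t) * q t * \<phi> t) \<le> norm (B * indicator {a..b} t)"
  proof (rule AE_I2)
    fix t
    have "norm (q t) * norm (\<phi> t) \<le> B * 1"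
      using q[of t] norm_\<phi>_le[of t] order_trans[OF norm_ge_zero q[of t]] by (intro mult_mono) auto
    then show "norm (complex_of_real (indicator S t) * q t * \<phi> t) \<le> norm (B * indicator {a..b} t)"
      using S by (auto simp: indicator_def norm_mult)
  qed
qed (simp_all add: integrable_indicator_Icc)

text \<open>
  The convolution of the density with the sinc kernel, which is the expectation of the estimator.
\<close>
definition smoothed :: "real \<Rightarrow> real \<Rightarrow> real" where
  "smoothed h x = (LINT y|lborel. sinc_kernel h (x - y) * f y)"

text \<open>
  Convolution with the kernel multiplies the characteristic function by the indicator of the band.
  The exchange formula moves the transform from \<open>f\<close> to the indicator, whose transform is the kernel.
\<close>
lemma smoothed_fourier:
  assumes h: "h > 0"
  shows "complex_of_real (2 * pi * smoothed h x) = fourier (-1) (\<lambda>t. complex_of_real (indicator {- (1/h)..1/h} t) * 1 * \<phi> t) x"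
proof -
  let ?b = "\<lambda>t. complex_of_real (indicator {- (1/h)..1/h} t)"
  have "fourier (-1) (\<lambda>t. ?b t * 1 * \<phi> t) x = (LINT t|lborel. (iexp ((-x) * t) * ?b t) * fourier 1 (\<lambda>y. complex_of_real (f y)) t)"
    unfolding fourier_def[of "-1"] \<phi>_def by (simp add: mult_ac)
  also have "\<dots> = (LINT y|lborel. complex_of_real (f y) * fourier 1 (\<lambda>t. iexp ((-x) * t) * ?b t) y)"
    using f_integrable by (intro fourier_exchange integrable_iexp_mult) (simp_all add: integrable_indicator_Icc)
  also have "\<dots> = (LINT y|lborel. complex_of_real (2 * pi * (sinc_kernel h (x - y) * f y)))"
  proof (intro Bochner_Integration.integral_cong refl)
    fix y
    have "fourier 1 (\<lambda>t. iexp ((-x) * t) * ?b t) y = fourier (-1) ?b (x - y)"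
      unfolding fourier_def by (simp add: mult.assoc[symmetric] exp_add[symmetric]) (simp add: algebra_simps)
    then show "complex_of_real (f y) * fourier 1 (\<lambda>t. iexp ((-x) * t) * ?b t) y = complex_of_real (2 * pi * (sinc_kernel h (x - y) * f y))"
      unfolding fourier_indicator[OF h] by (simp add: mult_ac)
  qed
  also have "\<dots> = complex_of_real (2 * pi * smoothed h x)"
    unfolding smoothed_def by (simp del: of_real_mult)
  finally show ?thesis by simp
qed

text \<open>
  One-sided averages of the density. They stand in for the density itself, because Fourier
  inversion holds for interval probabilities at every point while \<open>f\<close> may be discontinuous.
\<close>
definition local_average :: "real \<Rightarrow> real \<Rightarrow> real" where
  "local_average \<epsilon> x = measure (density lborel f) {x<..x + \<epsilon>} / \<epsilon>"

text \<open>
  The Fourier multiplier of the averaging operator. At \<open>t = 0\<close> it takes the value \<open>0\<close> instead of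
  the limit \<open>1\<close>, so estimates near \<open>1\<close> are stated for \<open>t \<noteq> 0\<close>.
\<close>
definition average_multiplier :: "real \<Rightarrow> real \<Rightarrow> complex" where
  "average_multiplier \<epsilon> t = (1 - iexp (- (t * \<epsilon>))) / (\<i> * t * \<epsilon>)"

lemma average_multiplier_measurable [measurable]: "average_multiplier \<epsilon> \<in> borel_measurable borel"
  unfolding average_multiplier_def by measurable

lemma norm_average_multiplier_le:
  assumes "\<epsilon> > 0"
  shows "norm (average_multiplier \<epsilon> t) \<le> 1"
proof (cases "t = 0")
  case True then show ?thesis by (simp add: average_multiplier_def)
next
  case False
  have "norm (iexp (- (t * \<epsilon>)) - 1) \<le> \<bar>t\<bar> * \<epsilon>"
    using iexp_approx1[of "- (t * \<epsilon>)" 0] assms by (simp add: abs_mult)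
  then show ?thesis
    using False assms by (simp add: average_multiplier_def norm_divide norm_mult norm_minus_commute)
qed

lemma norm_average_multiplier_minus_1:
  assumes "\<epsilon> > 0" "t \<noteq> 0"
  shows "norm (average_multiplier \<epsilon> t - 1) \<le> \<epsilon> * \<bar>t\<bar>"
proof -
  have "average_multiplier \<epsilon> t - 1 = - (iexp (- (t * \<epsilon>)) - (\<Sum>k\<le>1. (\<i> * complex_of_real (- (t * \<epsilon>))) ^ k / fact k)) / (\<i> * t * \<epsilon>)"
    using assms by (simp add: average_multiplier_def field_simps)
  also have "norm \<dots> = norm (iexp (- (t * \<epsilon>)) - (\<Sum>k\<le>1. (\<i> * complex_of_real (- (t * \<epsilon>))) ^ k / fact k)) / (\<bar>t\<bar> * \<epsilon>)"
    using assms by (simp add: norm_divide norm_mult norm_minus_commute)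
  also have "\<dots> \<le> (\<bar>- (t * \<epsilon>)\<bar> ^ Suc 1 / fact (Suc 1)) / (\<bar>t\<bar> * \<epsilon>)"
    using assms by (intro divide_right_mono iexp_approx1) auto
  also have "\<dots> = \<epsilon> * \<bar>t\<bar> / 2"
    using assms by (simp add: abs_mult field_simps power2_eq_square)
  also have "\<dots> \<le> \<epsilon> * \<bar>t\<bar>" using assms by simp
  finally show ?thesis .
qed

text \<open>
  Levy's inversion theorem for the interval from \<open>x\<close> to \<open>x + \<epsilon>\<close>, rewritten as inverse transforms
  over growing bands.
\<close>
lemma local_average_fourier_limit:
  assumes \<epsilon>: "\<epsilon> > 0"
  shows "(\<lambda>T::nat. fourier (-1) (\<lambda>t. complex_of_real (indicator {- real T<..<real T} t) * average_multiplier \<epsilon> t * \<phi> t) x)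
    \<longlonglongrightarrow> complex_of_real (2 * pi * local_average \<epsilon> x)"
proof -
  \<comment> \<open>Levy's theorem requires that the end points of the interval carry no mass.\<close>
  have null: "measure (density lborel f) {c} = 0" for c
    by (simp add: measure_def emeasure_density)
  have "(\<lambda>T::nat. 1 / (2 * pi) * (CLBINT t=-T..T. (iexp (-(t * x)) - iexp (-(t * (x + \<epsilon>)))) / (\<i> * t) * char (density lborel f) t))
    \<longlonglongrightarrow> complex_of_real (measure (density lborel f) {x<..x + \<epsilon>})"
    using \<epsilon> by (intro density.Levy_Inversion null) simp
  then have "(\<lambda>T::nat. complex_of_real (2 * pi / \<epsilon>) * (1 / (2 * pi) * (CLBINT t=-T..T. (iexp (-(t * x)) - iexp (-(t * (x + \<epsilon>)))) / (\<i> * t) * char (density lborel f) t)))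
    \<longlonglongrightarrow> complex_of_real (2 * pi / \<epsilon>) * complex_of_real (measure (density lborel f) {x<..x + \<epsilon>})"
    by (intro tendsto_mult tendsto_const)
  moreover have "complex_of_real (2 * pi / \<epsilon>) * complex_of_real (measure (density lborel f) {x<..x + \<epsilon>}) = complex_of_real (2 * pi * local_average \<epsilon> x)"
    by (simp add: local_average_def)
  moreover have "complex_of_real (2 * pi / \<epsilon>) * (1 / (2 * pi) * (CLBINT t=-T..T. (iexp (-(t * x)) - iexp (-(t * (x + \<epsilon>)))) / (\<i> * t) * char (density lborel f) t))
      = fourier (-1) (\<lambda>t. complex_of_real (indicator {- real T<..<real T} t) * average_multiplier \<epsilon> t * \<phi> t) x" for T :: nat
  proof -
    have integrand: "indicator {- real T<..<real T} t *\<^sub>R ((iexp (-(t * x)) - iexp (-(t * (x + \<epsilon>)))) / (\<i> * t) * \<phi> t)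
        = complex_of_real \<epsilon> * (iexp ((-1) * t * x) * (complex_of_real (indicator {- real T<..<real T} t) * average_multiplier \<epsilon> t * \<phi> t))" for t
    proof -
      have "iexp (-(t * (x + \<epsilon>))) = iexp (-(t * x)) * iexp (-(t * \<epsilon>))"
      proof -
        have "- (t * (x + \<epsilon>)) = - (t * x) + - (t * \<epsilon>)" by (simp add: algebra_simps)
        then show ?thesis by (simp only: of_real_add distrib_left exp_add)
      qed
      then have "(iexp (-(t * x)) - iexp (-(t * (x + \<epsilon>)))) / (\<i> * t) = complex_of_real \<epsilon> * (iexp ((-1) * t * x) * average_multiplier \<epsilon> t)"
        using \<epsilon> by (cases "t = 0") (simp_all add: average_multiplier_def field_simps)
      then show ?thesis by (simp add: scaleR_conv_of_real)
    qed
    have "(CLBINT t=-T..T. (iexp (-(t * x)) - iexp (-(t * (x + \<epsilon>)))) / (\<i> * t) * char (density lborel f) t)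
      = (LINT t|lborel. complex_of_real \<epsilon> * (iexp ((-1) * t * x) * (complex_of_real (indicator {- real T<..<real T} t) * average_multiplier \<epsilon> t * \<phi> t)))"
    proof -
      have "einterval (ereal (real_of_int (- int T))) (ereal (real T)) = {- real T<..<real T}"
        "ereal (real_of_int (- int T)) \<le> ereal (real T)"
        by auto
      then show ?thesis
        unfolding interval_lebesgue_integral_def set_lebesgue_integral_def char_density
        by (simp only: if_True) (intro Bochner_Integration.integral_cong refl, rule integrand)
    qed
    also have "\<dots> = complex_of_real \<epsilon> * fourier (-1) (\<lambda>t. complex_of_real (indicator {- real T<..<real T} t) * average_multiplier \<epsilon> t * \<phi> t) x"
      unfolding fourier_def by (rule integral_mult_right_zero)
    finally show ?thesis using \<epsilon> by simp
  qed
  ultimately show ?thesis by simp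
qed

text \<open>
  Lebesgue's differentiation theorem, since the averages are those of the integrable function \<open>f\<close>.
\<close>
lemma local_average_limit:
  shows "AE x in lborel. (\<lambda>k. local_average (1 / real (Suc k)) x) \<longlonglongrightarrow> f x"
proof -
  have "f integrable_on UNIV" using f_integrable by (rule integrable_on_lborel)
  then have "f integrable_on cbox a b" for a b
    by (rule integrable_on_subcbox) simp
  from integrable_ccontinuous_explicit[OF this] obtain N where N: "negligible N"
    and lim: "\<And>x e. x \<notin> N \<Longrightarrow> 0 < e \<Longrightarrow> \<exists>d>0. \<forall>h. 0 < h \<and> h < d \<longrightarrow>
      norm (integral (cbox x (x + h *\<^sub>R One)) f /\<^sub>R h ^ DIM(real) - f x) < e"
    by metis
  have avg: "integral (cbox x (x + h *\<^sub>R One)) f /\<^sub>R h ^ DIM(real) = local_average h x" if "h > 0" for x h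
  proof -
    have "measure (density lborel f) {x<..x + h} = (LINT y|density lborel f. indicator {x<..x + h} y)"
      by simp
    also have "\<dots> = (LINT y|lborel. f y *\<^sub>R indicator {x<..x + h} y)"
      using f_nonneg by (intro integral_density) auto
    also have "\<dots> = (LINT y:{x..x + h}|lborel. f y)"
      unfolding set_lebesgue_integral_def
      by (intro integral_cong_AE AE_mp[OF AE_lborel_singleton[of x] AE_I2]) (auto simp: indicator_def)
    also have "\<dots> = integral {x..x + h} f"
      using f_integrable unfolding set_integrable_def[symmetric]
      by (intro set_borel_integral_eq_integral) (simp add: set_integrable_def integrable_mult_indicator del: real_scaleR_def)
    finally show ?thesis using that by (simp add: local_average_def divide_inverse)
  qed
  have "(\<lambda>k. local_average (1 / real (Suc k)) x) \<longlonglongrightarrow> f x" if x: "x \<notin> N" for x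
  proof (rule LIMSEQ_I)
    fix e :: real assume "e > 0"
    from lim[OF x this] obtain d where d: "d > 0"
      "\<And>h. 0 < h \<Longrightarrow> h < d \<Longrightarrow> norm (local_average h x - f x) < e"
      by (metis avg)
    obtain k0 where k0: "1 / real (Suc k0) < d" using nat_approx_posE[OF d(1)] by blast
    show "\<exists>k0. \<forall>k\<ge>k0. norm (local_average (1 / real (Suc k)) x - f x) < e"
    proof (intro exI allI impI d(2))
      fix k assume "k0 \<le> k"
      then have "1 / real (Suc k) \<le> 1 / real (Suc k0)" by (simp add: frac_le)
      with k0 show "1 / real (Suc k) < d" by simp
    qed simp
  qed
  moreover have "AE x in lebesgue. x \<notin> N"
    using N by (intro AE_not_in) (simp add: negligible_iff_null_sets)
  ultimately have "AE x in lebesgue. (\<lambda>k. local_average (1 / real (Suc k)) x) \<longlonglongrightarrow> f x"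
    by (auto elim: eventually_mono)
  then show ?thesis by (simp add: AE_completion_iff)
qed

lemma smoothed_measurable [measurable]: "smoothed h \<in> borel_measurable borel"
  unfolding smoothed_def by measurable

lemma local_average_measurable [measurable]:
  assumes "\<epsilon> > 0"
  shows "local_average \<epsilon> \<in> borel_measurable borel"
proof -
  have "(\<lambda>x. complex_of_real (2 * pi * local_average \<epsilon> x)) \<in> borel_measurable borel"
    by (rule borel_measurable_LIMSEQ_metric[OF _ local_average_fourier_limit[OF assms]]) measurable
  then have "(\<lambda>x. Re (complex_of_real (2 * pi * local_average \<epsilon> x)) / (2 * pi)) \<in> borel_measurable borel"
    by measurable
  then show ?thesis by simp
qed

section \<open>The bias\<close>

text \<open>
  The difference of the two functions is the limit of inverse transforms of
  \<open>(indicator of (-T, T)) * q * \<phi> - (indicator of the band) * \<phi>\<close> with \<open>q\<close> the averaging multiplier.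
  Inside the band this is \<open>(q - 1) * \<phi>\<close>, of size at most \<open>\<epsilon> / h\<close>; outside, it is bounded by \<open>\<bar>\<phi>\<bar>\<close>, to
  which the decay applies.
\<close>
lemma local_average_bias:
  assumes h: "h > 0" and \<epsilon>: "\<epsilon> > 0" and decay: "\<And>t. norm (\<phi> t) * \<bar>t\<bar> ^ (m + 1) \<le> V"
  shows "(\<integral>\<^sup>+x. ennreal ((local_average \<epsilon> x - smoothed h x)\<^sup>2) \<partial>lborel)
    \<le> ennreal (1 / (2 * pi) * ((\<epsilon> / h)\<^sup>2 * (2 / h) + 2 * (V\<^sup>2 / (real (2 * m + 1) * (1 / h) ^ (2 * m + 1)))))"
    (is "_ \<le> ennreal (_ * (?A + ?B))")
proof (rule nn_integral_le_limit)
  define J where "J = {- (1 / h)..1 / h}"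
  define a where "a T t = complex_of_real (indicator {- real T<..<real T} t) * average_multiplier \<epsilon> t * \<phi> t" for T t
  define b where "b t = complex_of_real (indicator J t) * 1 * \<phi> t" for t
  define \<psi> where "\<psi> T t = a T t - b t" for T t
  have [measurable]: "b \<in> borel_measurable borel" "a T \<in> borel_measurable borel" "\<psi> T \<in> borel_measurable borel" for T
    unfolding a_def b_def \<psi>_def J_def by measurable
  have ai: "integrable lborel (a T)" for T
    unfolding a_def using norm_average_multiplier_le[OF \<epsilon>]
    by (intro integrable_band_limited[where B=1 and a="- real T" and b="real T"]) auto
  have bi: "integrable lborel b"
    unfolding b_def J_def by (intro integrable_band_limited[where B=1]) auto
  have \<psi>i: "integrable lborel (\<psi> T)" for T
    unfolding \<psi>_def using ai bi by (rule Bochner_Integration.integrable_diff)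
  define u where "u T x = ennreal ((norm (fourier (-1) (\<psi> T) x / (2 * pi)))\<^sup>2)" for T x
  show "u T \<in> borel_measurable lborel" for T
    unfolding u_def by measurable
  have "(\<lambda>T. u T x) \<longlonglongrightarrow> ennreal ((norm (complex_of_real (local_average \<epsilon> x - smoothed h x)))\<^sup>2)" for x
  proof -
    have "(\<lambda>T. fourier (-1) (a T) x - fourier (-1) b x)
      \<longlonglongrightarrow> complex_of_real (2 * pi * local_average \<epsilon> x) - complex_of_real (2 * pi * smoothed h x)"
      unfolding a_def b_def J_def smoothed_fourier[OF h]
      by (intro tendsto_diff local_average_fourier_limit[OF \<epsilon>] tendsto_const)
    then have "(\<lambda>T. (fourier (-1) (a T) x - fourier (-1) b x) / (2 * pi))
      \<longlonglongrightarrow> (complex_of_real (2 * pi * local_average \<epsilon> x) - complex_of_real (2 * pi * smoothed h x)) / (2 * pi)"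
      by (intro tendsto_divide tendsto_const) auto
    also have "(complex_of_real (2 * pi * local_average \<epsilon> x) - complex_of_real (2 * pi * smoothed h x)) / (2 * pi)
      = complex_of_real (local_average \<epsilon> x - smoothed h x)"
      by (simp add: diff_divide_distrib)
    finally show ?thesis
      unfolding u_def \<psi>_def fourier_diff[OF ai bi]
      by (intro tendsto_ennrealI tendsto_power tendsto_norm)
  qed
  then show "AE x in lborel. (\<lambda>T. u T x) \<longlonglongrightarrow> ennreal ((local_average \<epsilon> x - smoothed h x)\<^sup>2)"
    by (simp only: norm_of_real power2_abs) simp
  have scale: "ennreal (1 / (2 * pi)\<^sup>2) * (ennreal (2 * pi) * ennreal y) = ennreal (1 / (2 * pi) * y)" for y
  proof -
    have "ennreal (1 / (2 * pi)\<^sup>2) * (ennreal (2 * pi) * ennreal y) = ennreal (1 / (2 * pi)\<^sup>2 * (2 * pi * y))"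
      using ennreal_mult'[of "2 * pi" y] ennreal_mult'[of "1 / (2 * pi)\<^sup>2" "2 * pi * y"] by simp
    also have "1 / (2 * pi)\<^sup>2 * (2 * pi * y) = 1 / (2 * pi) * y"
      by (simp add: power2_eq_square)
    finally show ?thesis .
  qed
  \<comment> \<open>From \<open>T0\<close> on, the growing band contains the band of the kernel.\<close>
  obtain T0 :: nat where T0: "1 / h < real T0" using reals_Archimedean2 by blast
  have "integral\<^sup>N lborel (u T) \<le> ennreal (1 / (2 * pi) * (?A + ?B))" if "T \<ge> T0" for T
  proof -
    have T: "1 / h < real T" using T0 that by linarith
    have "integral\<^sup>N lborel (u T) = (\<integral>\<^sup>+x. ennreal (1 / (2 * pi)\<^sup>2) * ennreal ((norm (fourier (-1) (\<psi> T) x))\<^sup>2) \<partial>lborel)"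
      unfolding u_def by (intro nn_integral_cong) (simp add: norm_divide power_divide norm_mult flip: ennreal_mult')
    also have "\<dots> = ennreal (1 / (2 * pi)\<^sup>2) * (\<integral>\<^sup>+x. ennreal ((norm (fourier (-1) (\<psi> T) x))\<^sup>2) \<partial>lborel)"
      by (rule nn_integral_cmult) measurable
    also have "\<dots> \<le> ennreal (1 / (2 * pi)\<^sup>2) * (ennreal (2 * pi) * (\<integral>\<^sup>+t. ennreal ((norm (\<psi> T t))\<^sup>2) \<partial>lborel))"
      by (intro mult_left_mono plancherel_le \<psi>i) simp
    also have "(\<integral>\<^sup>+t. ennreal ((norm (\<psi> T t))\<^sup>2) \<partial>lborel)
        \<le> (\<integral>\<^sup>+t. ennreal ((\<epsilon> / h)\<^sup>2) * indicator J t + ennreal (V\<^sup>2 / \<bar>t\<bar> ^ (2 * m + 2)) * indicator {t. \<bar>t\<bar> \<ge> 1 / h} t \<partial>lborel)"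
    proof (rule nn_integral_mono_AE, rule AE_mp[OF AE_lborel_singleton[of 0] AE_I2], rule impI)
      fix t :: real assume t: "t \<noteq> 0"
      show "ennreal ((norm (\<psi> T t))\<^sup>2) \<le> ennreal ((\<epsilon> / h)\<^sup>2) * indicator J t
          + ennreal (V\<^sup>2 / \<bar>t\<bar> ^ (2 * m + 2)) * indicator {t. \<bar>t\<bar> \<ge> 1 / h} t"
      proof (cases "\<bar>t\<bar> \<le> 1 / h")
        case True
        then have inJ: "t \<in> J" "t \<in> {- real T<..<real T}" using T by (auto simp: J_def)
        have p: "\<psi> T t = (average_multiplier \<epsilon> t - 1) * \<phi> t"
          using inJ by (simp add: \<psi>_def a_def b_def left_diff_distrib)
        have "norm (\<psi> T t) \<le> (\<epsilon> * \<bar>t\<bar>) * 1"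
          unfolding p norm_mult
          using norm_average_multiplier_minus_1[OF \<epsilon> t] norm_\<phi>_le \<epsilon> by (intro mult_mono) auto
        also have "\<dots> \<le> \<epsilon> / h" using mult_left_mono[OF True, of \<epsilon>] \<epsilon> by simp
        finally have "ennreal ((norm (\<psi> T t))\<^sup>2) \<le> ennreal ((\<epsilon> / h)\<^sup>2)"
          by (intro ennreal_leI power_mono) auto
        then show ?thesis using inJ(1) by (simp add: add_increasing2)
      next
        case False
        then have out: "t \<notin> J" "t \<in> {t. \<bar>t\<bar> \<ge> 1 / h}" by (auto simp: J_def)
        have "norm (\<psi> T t) \<le> 1 * norm (\<phi> t)"
          using out norm_average_multiplier_le[OF \<epsilon>, of t] unfolding \<psi>_def a_def b_def norm_mult
          by (auto simp: norm_mult indicator_def intro!: mult_left_le_one_le)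
        also have "\<dots> \<le> V / \<bar>t\<bar> ^ (m + 1)"
          using decay[of t] t by (simp add: field_simps)
        finally have "(norm (\<psi> T t))\<^sup>2 \<le> (V / \<bar>t\<bar> ^ (m + 1))\<^sup>2"
          by (rule power_mono) simp
        also have "\<dots> = V\<^sup>2 / \<bar>t\<bar> ^ (2 * m + 2)"
          by (simp only: power_divide power_mult[symmetric] distrib_right mult_1 mult.commute[of 2])
        finally show ?thesis using out by (simp add: ennreal_leI)
      qed
    qed
    also have "\<dots> = ennreal ((\<epsilon> / h)\<^sup>2) * (\<integral>\<^sup>+t. indicator J t \<partial>lborel)
        + (\<integral>\<^sup>+t. ennreal (V\<^sup>2 / \<bar>t\<bar> ^ (2 * m + 2)) * indicator {t. \<bar>t\<bar> \<ge> 1 / h} t \<partial>lborel)"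
      by (subst nn_integral_add) (auto simp: J_def nn_integral_cmult)
    also have "\<dots> \<le> ennreal ((\<epsilon> / h)\<^sup>2) * ennreal (2 / h) + ennreal ?B"
      using h by (intro add_mono tail_integral) (auto simp: J_def)
    also have "\<dots> = ennreal (?A + ?B)"
      using h by (simp only: ennreal_mult'[OF zero_le_power2, symmetric]) (intro ennreal_plus[symmetric]; simp)
    also have "ennreal (1 / (2 * pi)\<^sup>2) * (ennreal (2 * pi) * ennreal (?A + ?B)) = ennreal (1 / (2 * pi) * (?A + ?B))"
      by (rule scale)
    finally show ?thesis by (auto simp: mult_left_mono)
  qed
  then show "\<forall>\<^sub>F T in sequentially. integral\<^sup>N lborel (u T) \<le> ennreal (1 / (2 * pi) * (?A + ?B))"
    by (intro eventually_sequentiallyI[of T0])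
qed simp

text \<open>
  Averaging over shrinking intervals removes the error made inside the band and leaves the
  contribution of the frequencies outside it.
\<close>
lemma bias_bound:
  assumes h: "h > 0" and decay: "\<And>t. norm (\<phi> t) * \<bar>t\<bar> ^ (m + 1) \<le> V"
  shows "(\<integral>\<^sup>+x. ennreal ((f x - smoothed h x)\<^sup>2) \<partial>lborel)
    \<le> ennreal (h ^ (2 * m + 1) * V\<^sup>2 / (real (2 * m + 1) * pi))"
proof (rule nn_integral_le_limit)
  define B where "B = 2 * (V\<^sup>2 / (real (2 * m + 1) * (1 / h) ^ (2 * m + 1)))"
  define C where "C k = 1 / (2 * pi) * ((1 / real (Suc k) / h)\<^sup>2 * (2 / h) + B)" for k
  have "(\<lambda>k. 1 / real (Suc k)) \<longlonglongrightarrow> 0"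
    using LIMSEQ_inverse_real_of_nat by (simp add: inverse_eq_divide)
  then have "C \<longlonglongrightarrow> 1 / (2 * pi) * ((0 / h)\<^sup>2 * (2 / h) + B)"
    unfolding C_def using h by (intro tendsto_intros) auto
  also have "1 / (2 * pi) * ((0 / h)\<^sup>2 * (2 / h) + B) = h ^ (2 * m + 1) * V\<^sup>2 / (real (2 * m + 1) * pi)"
    using h by (simp add: B_def power_one_over field_simps)
  finally show "(\<lambda>k. ennreal (C k)) \<longlonglongrightarrow> ennreal (h ^ (2 * m + 1) * V\<^sup>2 / (real (2 * m + 1) * pi))"
    by (rule tendsto_ennrealI)
  show "(\<lambda>x. ennreal ((local_average (1 / real (Suc k)) x - smoothed h x)\<^sup>2)) \<in> borel_measurable lborel" for k
    by measurable
  show "AE x in lborel. (\<lambda>k. ennreal ((local_average (1 / real (Suc k)) x - smoothed h x)\<^sup>2)) \<longlonglongrightarrow> ennreal ((f x - smoothed h x)\<^sup>2)"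
    using local_average_limit
    by eventually_elim (intro tendsto_ennrealI tendsto_power tendsto_diff tendsto_const)
  show "\<forall>\<^sub>F k in sequentially. (\<integral>\<^sup>+x. ennreal ((local_average (1 / real (Suc k)) x - smoothed h x)\<^sup>2) \<partial>lborel) \<le> ennreal (C k)"
    unfolding C_def B_def using decay by (intro always_eventually allI local_average_bias h) auto
qed

section \<open>The variance\<close>

text \<open>
  By Tonelli's theorem the second moments of \<open>sinc_kernel h (x - Y)\<close>, where \<open>Y\<close> has density \<open>f\<close>,
  integrate over \<open>x\<close> to the square integral of the kernel.
\<close>
lemma kernel_moment_integral:
  assumes h: "h > 0"
  shows "(\<integral>\<^sup>+x. ennreal (LINT y|lborel. (sinc_kernel h (x - y))\<^sup>2 * f y) \<partial>lborel) \<le> ennreal (1 / (pi * h))"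
proof -
  have "(\<integral>\<^sup>+x. ennreal (LINT y|lborel. (sinc_kernel h (x - y))\<^sup>2 * f y) \<partial>lborel)
    = (\<integral>\<^sup>+x. \<integral>\<^sup>+y. ennreal ((sinc_kernel h (x - y))\<^sup>2) * ennreal (f y) \<partial>lborel \<partial>lborel)"
  proof (intro nn_integral_cong)
    fix x
    have "integrable lborel (\<lambda>y. (sinc_kernel h (x - y))\<^sup>2 * f y)"
    proof (rule Bochner_Integration.integrable_bound)
      show "integrable lborel (\<lambda>y. (1 / (pi * h))\<^sup>2 * f y)" using f_integrable by simp
      have "(sinc_kernel h u)\<^sup>2 \<le> (1 / (pi * h))\<^sup>2" for u
        using power_mono[OF abs_sinc_kernel_le[OF h, of u], of 2] by simp
      then show "AE y in lborel. norm ((sinc_kernel h (x - y))\<^sup>2 * f y) \<le> norm ((1 / (pi * h))\<^sup>2 * f y)"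
        using f_nonneg by (intro AE_I2) (simp add: abs_mult mult_right_mono)
    qed measurable
    then show "ennreal (LINT y|lborel. (sinc_kernel h (x - y))\<^sup>2 * f y) = (\<integral>\<^sup>+y. ennreal ((sinc_kernel h (x - y))\<^sup>2) * ennreal (f y) \<partial>lborel)"
      using f_nonneg by (subst nn_integral_eq_integral[symmetric]) (auto simp: ennreal_mult')
  qed
  also have "\<dots> = (\<integral>\<^sup>+y. \<integral>\<^sup>+x. ennreal ((sinc_kernel h (x - y))\<^sup>2) * ennreal (f y) \<partial>lborel \<partial>lborel)"
    by (rule lborel_pair.Fubini') measurable
  also have "\<dots> = (\<integral>\<^sup>+y. (\<integral>\<^sup>+u. ennreal ((sinc_kernel h u)\<^sup>2) \<partial>lborel) * ennreal (f y) \<partial>lborel)"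
  proof (intro nn_integral_cong)
    fix y
    have "(\<integral>\<^sup>+x. ennreal ((sinc_kernel h (x - y))\<^sup>2) * ennreal (f y) \<partial>lborel) = (\<integral>\<^sup>+x. ennreal ((sinc_kernel h (x - y))\<^sup>2) \<partial>lborel) * ennreal (f y)"
      by (rule nn_integral_multc) measurable
    also have "(\<integral>\<^sup>+x. ennreal ((sinc_kernel h (x - y))\<^sup>2) \<partial>lborel) = (\<integral>\<^sup>+u. ennreal ((sinc_kernel h u)\<^sup>2) \<partial>lborel)"
      by (subst nn_integral_real_affine[where c=1 and t=y]) simp_all
    finally show "(\<integral>\<^sup>+x. ennreal ((sinc_kernel h (x - y))\<^sup>2) * ennreal (f y) \<partial>lborel) = (\<integral>\<^sup>+u. ennreal ((sinc_kernel h u)\<^sup>2) \<partial>lborel) * ennreal (f y)" .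
  qed
  also have "\<dots> = (\<integral>\<^sup>+u. ennreal ((sinc_kernel h u)\<^sup>2) \<partial>lborel)"
    by (simp add: nn_integral_cmult f_total)
  also have "\<dots> \<le> ennreal (1 / (pi * h))" by (rule sinc_kernel_square_integral[OF h])
  finally show ?thesis .
qed

end

text \<open>
  The bias-variance decomposition: the centred variables are uncorrelated, so the cross terms
  vanish. The variance of a single variable is estimated by its second moment.
\<close>
lemma (in prob_space) mean_square_error_of_average:
  fixes Y :: "nat \<Rightarrow> 'a \<Rightarrow> real"
  assumes indep: "indep_vars (\<lambda>_. borel) Y {1..n}" and n: "n \<ge> 1"
    and bounded: "\<And>j \<omega>. \<bar>Y j \<omega>\<bar> \<le> B"
    and mean: "\<And>j. j \<in> {1..n} \<Longrightarrow> expectation (Y j) = \<mu>"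
    and moment: "\<And>j. j \<in> {1..n} \<Longrightarrow> expectation (\<lambda>\<omega>. (Y j \<omega>)\<^sup>2) = v"
  shows "(\<integral>\<^sup>+\<omega>. ennreal ((1 / n * (\<Sum>j=1..n. Y j \<omega>) - c)\<^sup>2) \<partial>M) \<le> ennreal (v / n + (\<mu> - c)\<^sup>2)"
proof -
  have rv [measurable]: "Y j \<in> borel_measurable M" if "j \<in> {1..n}" for j
    using indep that by (auto simp: indep_vars_def)
  have bint: "integrable M g" if "g \<in> borel_measurable M" "\<And>\<omega>. \<bar>g \<omega>\<bar> \<le> D" for g :: "'a \<Rightarrow> real" and D
    using that by (intro integrable_const_bound[of _ D]) auto
  \<comment> \<open>The centred variables; the bound on them makes all moments finite.\<close>
  define Z where "Z j \<omega> = Y j \<omega> - \<mu>" for j \<omega>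
  have Zm [measurable]: "Z j \<in> borel_measurable M" if "j \<in> {1..n}" for j
    unfolding Z_def using rv[OF that] by measurable
  have Zb: "\<bar>Z j \<omega>\<bar> \<le> B + \<bar>\<mu>\<bar>" for j \<omega>
    using bounded[of j \<omega>] unfolding Z_def by linarith
  have ZZb: "\<bar>Z i \<omega> * Z j \<omega>\<bar> \<le> (B + \<bar>\<mu>\<bar>) * (B + \<bar>\<mu>\<bar>)" for i j \<omega>
    unfolding abs_mult using order_trans[OF abs_ge_zero Zb] by (intro mult_mono Zb) auto
  have Zi: "integrable M (Z j)" if "j \<in> {1..n}" for j
    using Zb by (intro bint Zm that)
  have Yi: "integrable M (Y j)" if "j \<in> {1..n}" for j
    using bounded by (intro bint rv that)
  have ZZi: "integrable M (\<lambda>\<omega>. Z i \<omega> * Z j \<omega>)" if "i \<in> {1..n}" "j \<in> {1..n}" for i j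
    using ZZb that by (intro bint borel_measurable_times Zm)
  have Y2i: "integrable M (\<lambda>\<omega>. (Y j \<omega>)\<^sup>2)" if "j \<in> {1..n}" for j
  proof (rule bint)
    show "\<bar>(Y j \<omega>)\<^sup>2\<bar> \<le> B\<^sup>2" for \<omega> using bounded[of j \<omega>] power_mono[OF bounded[of j \<omega>], of 2] by simp
    show "(\<lambda>\<omega>. (Y j \<omega>)\<^sup>2) \<in> borel_measurable M" using rv[OF that] by measurable
  qed
  have EZ: "expectation (Z j) = 0" if "j \<in> {1..n}" for j
    unfolding Z_def using mean[OF that] Yi[OF that] by (simp add: prob_space)
  have indZ: "indep_vars (\<lambda>_. borel) Z {1..n}"
    unfolding Z_def using indep by (rule indep_vars_compose2) auto
  have cross: "expectation (\<lambda>\<omega>. Z i \<omega> * Z j \<omega>) = 0" if "i \<in> {1..n}" "j \<in> {1..n}" "i \<noteq> j" for i j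
  proof -
    have "expectation (\<lambda>\<omega>. \<Prod>k\<in>{i, j}. Z k \<omega>) = (\<Prod>k\<in>{i, j}. expectation (Z k))"
      using that Zi by (intro indep_vars_lebesgue_integral indep_vars_subset[OF indZ]) auto
    then show ?thesis using that EZ by simp
  qed
  have diag: "expectation (\<lambda>\<omega>. Z j \<omega> * Z j \<omega>) \<le> v" if "j \<in> {1..n}" for j
  proof -
    have "expectation (\<lambda>\<omega>. Z j \<omega> * Z j \<omega>) = expectation (\<lambda>\<omega>. (Y j \<omega>)\<^sup>2 - 2 * \<mu> * Y j \<omega> + \<mu>\<^sup>2)"
      unfolding Z_def by (simp add: power2_eq_square algebra_simps)
    also have "\<dots> = v - 2 * \<mu> * \<mu> + \<mu>\<^sup>2"
      using Yi[OF that] Y2i[OF that] mean[OF that] moment[OF that] by (simp add: prob_space)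
    finally show ?thesis by (simp add: power2_eq_square)
  qed
  define S where "S \<omega> = (\<Sum>j=1..n. Z j \<omega>)" for \<omega>
  have S2: "(\<lambda>\<omega>. (S \<omega>)\<^sup>2) = (\<lambda>\<omega>. \<Sum>i=1..n. \<Sum>j=1..n. Z i \<omega> * Z j \<omega>)"
    unfolding S_def by (simp add: power2_eq_square sum_product)
  have S2i: "integrable M (\<lambda>\<omega>. (S \<omega>)\<^sup>2)"
    unfolding S2 using ZZi by (intro Bochner_Integration.integrable_sum) auto
  have Si: "integrable M S"
    unfolding S_def using Zi by (intro Bochner_Integration.integrable_sum) auto
  have ES: "expectation S = 0"
    unfolding S_def using Zi EZ by (subst Bochner_Integration.integral_sum) auto
  have "expectation (\<lambda>\<omega>. (S \<omega>)\<^sup>2) = (\<Sum>i=1..n. expectation (\<lambda>\<omega>. \<Sum>j=1..n. Z i \<omega> * Z j \<omega>))"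
    unfolding S2 by (intro Bochner_Integration.integral_sum Bochner_Integration.integrable_sum ZZi)
  also have "\<dots> = (\<Sum>i=1..n. \<Sum>j=1..n. expectation (\<lambda>\<omega>. Z i \<omega> * Z j \<omega>))"
    by (intro sum.cong refl Bochner_Integration.integral_sum ZZi)
  also have "\<dots> = (\<Sum>i=1..n. \<Sum>j=1..n. if j = i then expectation (\<lambda>\<omega>. Z i \<omega> * Z i \<omega>) else 0)"
    using cross by (intro sum.cong refl) auto
  also have "\<dots> = (\<Sum>i=1..n. expectation (\<lambda>\<omega>. Z i \<omega> * Z i \<omega>))"
    by (intro sum.cong refl) (auto simp: sum.delta)
  also have "\<dots> \<le> (\<Sum>i=1..n. v)" by (intro sum_mono diag)
  finally have ES2: "expectation (\<lambda>\<omega>. (S \<omega>)\<^sup>2) \<le> n * v" by simp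
  have e: "(1 / n * (\<Sum>j=1..n. Y j \<omega>) - c)\<^sup>2 = 1 / n\<^sup>2 * (S \<omega>)\<^sup>2 + 2 * (\<mu> - c) / n * S \<omega> + (\<mu> - c)\<^sup>2" for \<omega>
  proof -
    have "1 / n * (\<Sum>j=1..n. Y j \<omega>) - c = S \<omega> / n + (\<mu> - c)"
      using n by (simp add: S_def Z_def sum_subtractf diff_divide_distrib)
    then show ?thesis by (simp only: power2_sum power_divide) (simp add: mult_ac)
  qed
  have i: "integrable M (\<lambda>\<omega>. 1 / n\<^sup>2 * (S \<omega>)\<^sup>2 + 2 * (\<mu> - c) / n * S \<omega> + (\<mu> - c)\<^sup>2)"
    using S2i Si by (intro Bochner_Integration.integrable_add integrable_mult_right integrable_const)
  have "(\<integral>\<^sup>+\<omega>. ennreal ((1 / n * (\<Sum>j=1..n. Y j \<omega>) - c)\<^sup>2) \<partial>M)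
    = ennreal (expectation (\<lambda>\<omega>. 1 / n\<^sup>2 * (S \<omega>)\<^sup>2 + 2 * (\<mu> - c) / n * S \<omega> + (\<mu> - c)\<^sup>2))"
    unfolding e[symmetric] using i[folded e] by (intro nn_integral_eq_integral) simp_all
  also have "expectation (\<lambda>\<omega>. 1 / n\<^sup>2 * (S \<omega>)\<^sup>2 + 2 * (\<mu> - c) / n * S \<omega> + (\<mu> - c)\<^sup>2)
    = 1 / n\<^sup>2 * expectation (\<lambda>\<omega>. (S \<omega>)\<^sup>2) + (\<mu> - c)\<^sup>2"
    using S2i Si ES by (simp add: prob_space)
  also have "ennreal \<dots> \<le> ennreal (1 / n\<^sup>2 * (n * v) + (\<mu> - c)\<^sup>2)"
    using ES2 by (intro ennreal_leI add_right_mono mult_left_mono) auto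
  also have "1 / n\<^sup>2 * (n * v) = v / n" using n by (simp add: power2_eq_square)
  finally show ?thesis .
qed

lemma sinc_estimator_eq_average:
  "sinc_estimator n X h x = 1 / n * (\<Sum>j=1..n. sinc_kernel h (x - X j))"
proof -
  have "(\<Sum>j=1..n. sinc_kernel h (x - X j)) = (\<Sum>j=1..n. if x = X j then 1 / h else sin ((x - X j) / h) / (x - X j)) / pi"
    unfolding sinc_kernel_def sum_divide_distrib by simp
  then show ?thesis unfolding sinc_estimator_def by simp
qed

section \<open>The mean integrated squared error\<close>

theorem theorem8p2:
  fixes M :: "'a measure" and X :: "nat \<Rightarrow> 'a \<Rightarrow> real" and f :: "real \<Rightarrow> real"
    and n m :: nat and h :: real
  assumes "prob_space M"
    and "n \<ge> 1"
    and "h > 0"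
    and "prob_space.indep_vars M (\<lambda>_. borel) X {1..n}"
    and "\<And>x. f x \<ge> 0"
    and "\<And>j. j \<in> {1..n} \<Longrightarrow> distributed M lborel (X j) (\<lambda>x. ennreal (f x))"
    and "times_differentiable m f"
    and "total_variation ((deriv ^^ m) f) < \<infinity>"
  shows "MISE M (\<lambda>\<omega>. sinc_estimator n (\<lambda>j. X j \<omega>) h) f
    \<le> ennreal (h ^ (2 * m + 1) * (enn2real (total_variation ((deriv ^^ m) f)))\<^sup>2
                  / (real (2 * m + 1) * pi)
                + 1 / (pi * real n * h))"
proof -
  interpret prob_space M by fact
  note n = assms(2) and h = assms(3) and indep = assms(4) and nonneg = assms(5) and dens = assms(6)
  have "1 \<in> {1..n}" using n by simp
  note d1 = dens[OF this]
  interpret density_function f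
  proof
    show "f \<in> borel_measurable borel"
      using distributed_real_measurable[OF nonneg d1] by simp
    show "f x \<ge> 0" for x by (rule nonneg)
    show "(\<integral>\<^sup>+x. ennreal (f x) \<partial>lborel) = 1"
      using distributed_nn_integral[OF d1, of "\<lambda>_. 1"] by (simp add: emeasure_space_1)
  qed
  have Xm [measurable]: "X j \<in> borel_measurable M" if "j \<in> {1..n}" for j
    using distributed_measurable[OF dens[OF that]] by simp
  define V where "V = enn2real (total_variation ((deriv ^^ m) f))"
  have V: "total_variation ((deriv ^^ m) f) \<le> ennreal V" "V \<ge> 0"
    using assms(8) by (simp_all add: V_def ennreal_enn2real_if)
  have decay: "norm (\<phi> t) * \<bar>t\<bar> ^ (m + 1) \<le> V" for t
    unfolding \<phi>_def by (rule fourier_decay[OF f_integrable assms(7) V])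
  define v where "v x = (LINT y|lborel. (sinc_kernel h (x - y))\<^sup>2 * f y)" for x
  have [measurable]: "v \<in> borel_measurable borel" unfolding v_def by measurable
  have pointwise: "(\<integral>\<^sup>+\<omega>. ennreal ((sinc_estimator n (\<lambda>j. X j \<omega>) h x - f x)\<^sup>2) \<partial>M)
      \<le> ennreal (v x / n + (smoothed h x - f x)\<^sup>2)" for x
    unfolding sinc_estimator_eq_average
  proof (rule mean_square_error_of_average[OF _ n])
    show "indep_vars (\<lambda>_. borel) (\<lambda>j \<omega>. sinc_kernel h (x - X j \<omega>)) {1..n}"
      using indep by (rule indep_vars_compose2) measurable
    show "\<bar>sinc_kernel h (x - X j \<omega>)\<bar> \<le> 1 / (pi * h)" for j \<omega>
      by (rule abs_sinc_kernel_le[OF h])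
    fix j assume j: "j \<in> {1..n}"
    show "expectation (\<lambda>\<omega>. sinc_kernel h (x - X j \<omega>)) = smoothed h x"
      using distributed_integral[OF dens[OF j], of "\<lambda>y. sinc_kernel h (x - y)"] nonneg
      by (simp add: smoothed_def mult.commute)
    show "expectation (\<lambda>\<omega>. (sinc_kernel h (x - X j \<omega>))\<^sup>2) = v x"
      using distributed_integral[OF dens[OF j], of "\<lambda>y. (sinc_kernel h (x - y))\<^sup>2"] nonneg
      by (simp add: v_def mult.commute)
  qed
  interpret P: pair_sigma_finite M lborel ..
  have "MISE M (\<lambda>\<omega>. sinc_estimator n (\<lambda>j. X j \<omega>) h) f
    = (\<integral>\<^sup>+x. \<integral>\<^sup>+\<omega>. ennreal ((sinc_estimator n (\<lambda>j. X j \<omega>) h x - f x)\<^sup>2) \<partial>M \<partial>lborel)"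
    unfolding MISE_def sinc_estimator_eq_average by (rule P.Fubini'[symmetric]) measurable
  also have "\<dots> \<le> (\<integral>\<^sup>+x. ennreal (1 / n) * ennreal (v x) + ennreal ((f x - smoothed h x)\<^sup>2) \<partial>lborel)"
  proof (intro nn_integral_mono order_trans[OF pointwise])
    fix x
    have "v x \<ge> 0" unfolding v_def using f_nonneg by simp
    then show "ennreal (v x / n + (smoothed h x - f x)\<^sup>2) \<le> ennreal (1 / n) * ennreal (v x) + ennreal ((f x - smoothed h x)\<^sup>2)"
      by (simp add: ennreal_mult'[symmetric] power2_commute)
  qed
  also have "\<dots> = ennreal (1 / n) * (\<integral>\<^sup>+x. ennreal (v x) \<partial>lborel) + (\<integral>\<^sup>+x. ennreal ((f x - smoothed h x)\<^sup>2) \<partial>lborel)"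
    by (simp add: nn_integral_add nn_integral_cmult)
  also have "\<dots> \<le> ennreal (1 / n) * ennreal (1 / (pi * h)) + ennreal (h ^ (2 * m + 1) * V\<^sup>2 / (real (2 * m + 1) * pi))"
    unfolding v_def by (intro add_mono mult_left_mono kernel_moment_integral h bias_bound decay) simp
  also have "\<dots> = ennreal (h ^ (2 * m + 1) * V\<^sup>2 / (real (2 * m + 1) * pi) + 1 / (pi * real n * h))"
    using h by (subst ennreal_mult'[symmetric]) (simp_all add: ennreal_plus[symmetric] add.commute mult_ac del: ennreal_plus)
  finally show ?thesis unfolding V_def .
qed

end
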